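(* For $i=1,2$ let $\lambda_i\in\mathbb{C}^*$, $\alpha_i\in\mathbb{C}\setminus\{0\}$, and $h_i=\xi_it+\eta_i\in\mathbb{C}[t]$ with $\xi_i\neq 0$. Let $V_1,V_2$ be irreducible $\mathrm{Vir}$-modules such that $d_k$ acts locally finitely on both for all sufficiently large $k\in\mathbb{Z}_+$. Then $\Omega(\lambda_1,\alpha_1,h_1)\otimes V_1\cong\Omega(\lambda_2,\alpha_2,h_2)\otimes V_2$ as $\mathrm{Vir}$-modules if and only if $\lambda_1=\lambda_2$, $\alpha_1\xi_1=\alpha_2\xi_2$, and $V_1\cong V_2$ as $\mathrm{Vir}$-modules. Moreover, any such isomorphism is of the form $$\phi\otimes\tau:\ \Omega(\lambda_1,\alpha_1,h_1)\otimes V_1\to\Omega(\lambda_1,\alpha_2,h_2)\otimes V_2,\quad f\otimes v\mapsto\phi(f)\otimes\tau(v),$$ where $\tau:V_1\to V_2$ is a $\mathrm{Vir}$-module isomorphism and $\phi$ is the linear map with $\phi(s^ih_1^n)=s^ig_n(h_2)$ for all $n,i\in\mathbb{Z}_+$, where $g_n(x)=\sum_{i=0}^n\binom{n}{i}b_{n-i}x^i$ and $b_0=1$, $b_1=0$, $b_{i+1}=ib_i+i(\eta_2-\eta_1)b_{i-1}$ for $i\in\mathbb{N}$.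
   Context: $\mathrm{Vir}$ is the Lie algebra with basis $\{d_i,c\mid i\in\mathbb{Z}\}$ and brackets $[d_i,d_j]=(j-i)d_{i+j}+\delta_{i,-j}\frac{i^3-i}{12}c$, $[c,d_i]=0$. For $\lambda\in\mathbb{C}^*$, $\alpha\in\mathbb{C}$, $h\in\mathbb{C}[t]$, define operators on $\mathbb{C}[t]$ by $F(f)=\frac{h(t)-h(\alpha)}{t-\alpha}f(t)-f'(t)$ and $G(f)=h(\alpha)f+tF(f)$. The $\mathrm{Vir}$-module $\Omega(\lambda,\alpha,h)$ is the vector space $\mathbb{C}[t,s]$ with $c$ acting as $0$ and $d_m(f(t)s^i)=\lambda^m(s-m)^i\big(sf+mG(f)-m^2\alpha F(f)\big)$ for $m\in\mathbb{Z}$, $i\in\mathbb{Z}_+$, $f\in\mathbb{C}[t]$. Tensor products of $\mathrm{Vir}$-modules carry the action $x(a\otimes v)=xa\otimes v+a\otimes xv$. *)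

theory Defs
  imports Complex_Main "HOL-Computational_Algebra.Polynomial" "HOL-Library.Function_Algebras"
begin

definition vir_module ::
  "(complex \<Rightarrow> 'a::ab_group_add \<Rightarrow> 'a) \<Rightarrow> 'a set \<Rightarrow> (int \<Rightarrow> 'a \<Rightarrow> 'a) \<Rightarrow> ('a \<Rightarrow> 'a) \<Rightarrow> bool" where
  "vir_module sc M D C \<longleftrightarrow>
     vector_space sc \<and> 0 \<in> M \<and> (\<forall>x\<in>M. \<forall>y\<in>M. x + y \<in> M) \<and> (\<forall>a. \<forall>x\<in>M. sc a x \<in> M) \<and>
     (\<forall>m. \<forall>x\<in>M. D m x \<in> M) \<and> (\<forall>x\<in>M. C x \<in> M) \<and>
     (\<forall>m. \<forall>x\<in>M. \<forall>y\<in>M. D m (x + y) = D m x + D m y) \<and>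
     (\<forall>m a. \<forall>x\<in>M. D m (sc a x) = sc a (D m x)) \<and>
     (\<forall>x\<in>M. \<forall>y\<in>M. C (x + y) = C x + C y) \<and>
     (\<forall>a. \<forall>x\<in>M. C (sc a x) = sc a (C x)) \<and>
     (\<forall>i j. \<forall>x\<in>M. D i (D j x) - D j (D i x) =
          sc (of_int (j - i)) (D (i + j) x)
          + (if i = - j then sc (of_int (i ^ 3 - i) / 12) (C x) else 0)) \<and>
     (\<forall>i. \<forall>x\<in>M. C (D i x) = D i (C x))"

definition vir_submodule ::
  "(complex \<Rightarrow> 'a::ab_group_add \<Rightarrow> 'a) \<Rightarrow> 'a set \<Rightarrow> (int \<Rightarrow> 'a \<Rightarrow> 'a) \<Rightarrow> ('a \<Rightarrow> 'a) \<Rightarrow> 'a set \<Rightarrow> bool" where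
  "vir_submodule sc M D C N \<longleftrightarrow>
     N \<subseteq> M \<and> 0 \<in> N \<and> (\<forall>x\<in>N. \<forall>y\<in>N. x + y \<in> N) \<and> (\<forall>a. \<forall>x\<in>N. sc a x \<in> N) \<and>
     (\<forall>m. \<forall>x\<in>N. D m x \<in> N) \<and> (\<forall>x\<in>N. C x \<in> N)"

definition vir_irreducible ::
  "(complex \<Rightarrow> 'a::ab_group_add \<Rightarrow> 'a) \<Rightarrow> 'a set \<Rightarrow> (int \<Rightarrow> 'a \<Rightarrow> 'a) \<Rightarrow> ('a \<Rightarrow> 'a) \<Rightarrow> bool" where
  "vir_irreducible sc M D C \<longleftrightarrow>
     vir_module sc M D C \<and> M \<noteq> {0} \<and>
     (\<forall>N. vir_submodule sc M D C N \<longrightarrow> N = {0} \<or> N = M)"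

definition vir_iso ::
  "(complex \<Rightarrow> 'a::ab_group_add \<Rightarrow> 'a) \<Rightarrow> 'a set \<Rightarrow> (int \<Rightarrow> 'a \<Rightarrow> 'a) \<Rightarrow> ('a \<Rightarrow> 'a) \<Rightarrow>
   (complex \<Rightarrow> 'b::ab_group_add \<Rightarrow> 'b) \<Rightarrow> 'b set \<Rightarrow> (int \<Rightarrow> 'b \<Rightarrow> 'b) \<Rightarrow> ('b \<Rightarrow> 'b) \<Rightarrow>
   ('a \<Rightarrow> 'b) \<Rightarrow> bool" where
  "vir_iso sc1 M1 D1 C1 sc2 M2 D2 C2 f \<longleftrightarrow>
     bij_betw f M1 M2 \<and>
     (\<forall>x\<in>M1. \<forall>y\<in>M1. f (x + y) = f x + f y) \<and>
     (\<forall>a. \<forall>x\<in>M1. f (sc1 a x) = sc2 a (f x)) \<and>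
     (\<forall>m. \<forall>x\<in>M1. f (D1 m x) = D2 m (f x)) \<and>
     (\<forall>x\<in>M1. f (C1 x) = C2 (f x))"

definition vir_isomorphic ::
  "(complex \<Rightarrow> 'a::ab_group_add \<Rightarrow> 'a) \<Rightarrow> 'a set \<Rightarrow> (int \<Rightarrow> 'a \<Rightarrow> 'a) \<Rightarrow> ('a \<Rightarrow> 'a) \<Rightarrow>
   (complex \<Rightarrow> 'b::ab_group_add \<Rightarrow> 'b) \<Rightarrow> 'b set \<Rightarrow> (int \<Rightarrow> 'b \<Rightarrow> 'b) \<Rightarrow> ('b \<Rightarrow> 'b) \<Rightarrow> bool" where
  "vir_isomorphic sc1 M1 D1 C1 sc2 M2 D2 C2 \<longleftrightarrow> (\<exists>f. vir_iso sc1 M1 D1 C1 sc2 M2 D2 C2 f)"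

definition locally_finite_op ::
  "(complex \<Rightarrow> 'a::ab_group_add \<Rightarrow> 'a) \<Rightarrow> 'a set \<Rightarrow> ('a \<Rightarrow> 'a) \<Rightarrow> bool" where
  "locally_finite_op sc M T \<longleftrightarrow>
     (\<forall>v\<in>M. \<exists>B. finite B \<and> B \<subseteq> M \<and> (\<forall>n. (T ^^ n) v \<in> module.span sc B))"

text \<open>Elements of C[t,s] are represented as polynomials in s with coefficients in C[t],
 i.e. by the type complex poly poly (outer variable s, inner variable t).\<close>

definition Fop :: "complex \<Rightarrow> complex poly \<Rightarrow> complex poly \<Rightarrow> complex poly" where
  "Fop \<alpha> h f = ((h - [:poly h \<alpha>:]) div [:- \<alpha>, 1:]) * f - pderiv f"

definition Gop :: "complex \<Rightarrow> complex poly \<Rightarrow> complex poly \<Rightarrow> complex poly" where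
  "Gop \<alpha> h f = smult (poly h \<alpha>) f + [:0, 1:] * Fop \<alpha> h f"

definition omega_act ::
  "complex \<Rightarrow> complex \<Rightarrow> complex poly \<Rightarrow> int \<Rightarrow> complex poly poly \<Rightarrow> complex poly poly" where
  "omega_act lam \<alpha> h m P =
     (\<Sum>i\<le>degree P.
        [:[:lam powi m:]:] * [:- [:of_int m:], 1:] ^ i *
        ([:0, 1:] * [:coeff P i:]
         + [: smult (of_int m) (Gop \<alpha> h (coeff P i))
              - smult ((of_int m)\<^sup>2 * \<alpha>) (Fop \<alpha> h (coeff P i)) :]))"

text \<open>Since C[t,s] has the basis t^a s^i, Omega \<otimes> V is identified with finitely supported
 functions (a,i) \<mapsto> v_{a,i} in V, i.e. \<Sum> t^a s^i \<otimes> v_{a,i}.\<close>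

definition tens_carrier :: "(nat \<times> nat \<Rightarrow> 'v::zero) set" where
  "tens_carrier = {F. finite {k. F k \<noteq> 0}}"

definition tens_scale :: "(complex \<Rightarrow> 'v \<Rightarrow> 'v) \<Rightarrow> complex \<Rightarrow> (nat \<times> nat \<Rightarrow> 'v) \<Rightarrow> (nat \<times> nat \<Rightarrow> 'v)" where
  "tens_scale sc a F = (\<lambda>k. sc a (F k))"

text \<open>The pure tensor P \<otimes> v (coefficient of t^a s^i in P is coeff (coeff P i) a).\<close>
definition tens :: "(complex \<Rightarrow> 'v \<Rightarrow> 'v) \<Rightarrow> complex poly poly \<Rightarrow> 'v \<Rightarrow> (nat \<times> nat \<Rightarrow> 'v)" where
  "tens sc P v = (\<lambda>(a, i). sc (coeff (coeff P i) a) v)"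

definition tens_act ::
  "(complex \<Rightarrow> 'v::ab_group_add \<Rightarrow> 'v) \<Rightarrow> complex \<Rightarrow> complex \<Rightarrow> complex poly \<Rightarrow> (int \<Rightarrow> 'v \<Rightarrow> 'v) \<Rightarrow>
   int \<Rightarrow> (nat \<times> nat \<Rightarrow> 'v) \<Rightarrow> (nat \<times> nat \<Rightarrow> 'v)" where
  "tens_act sc lam \<alpha> h D m F =
     (\<Sum>k\<in>{k. F k \<noteq> 0}. tens sc (omega_act lam \<alpha> h m (monom (monom 1 (fst k)) (snd k))) (F k))
     + (\<lambda>k. D m (F k))"

text \<open>c acts as 0 on Omega, so on the tensor product it acts through V only.\<close>
definition tens_C :: "('v \<Rightarrow> 'v) \<Rightarrow> (nat \<times> nat \<Rightarrow> 'v) \<Rightarrow> (nat \<times> nat \<Rightarrow> 'v)" where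
  "tens_C C F = (\<lambda>k. C (F k))"

fun bseq :: "complex \<Rightarrow> nat \<Rightarrow> complex" where
  "bseq c 0 = 1"
| "bseq c (Suc 0) = 0"
| "bseq c (Suc (Suc i)) = of_nat (Suc i) * bseq c (Suc i) + of_nat (Suc i) * c * bseq c i"

definition gpoly :: "complex \<Rightarrow> nat \<Rightarrow> complex poly \<Rightarrow> complex poly" where
  "gpoly c n h = (\<Sum>j\<le>n. smult (of_nat (n choose j) * bseq c (n - j)) (h ^ j))"

end

(* Write x for the linear polynomial h and f' for the derivative with respect to x. Then
   alpha F f = beta (f - f') and G f = x f + beta f - (x - eta) f' with beta = alpha xi, so that
   Omega depends on lambda, beta and eta only.

   If d_k acts locally finitely on an irreducible module V, some v in V is an eigenvector of d_k, and
   the vectors y_i = d_i v with i > k satisfy (d_k - a) y_i = (i - k) y_{i+k}. They span a space of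
   finite dimension. Hence some nonzero combination of the d_i and its shift by k annihilate v and
   all y_i, and their commutators with the d_m give a linear recurrence with constant coefficients
   for (y_i). But y_{j+rk} is (d_k - a)^r y_j divided by a product of size at least r!, so it decays
   too fast to satisfy such a recurrence unless it vanishes eventually. By irreducibility every
   vector of V is annihilated by d_n for all large n.

   On a given vector of the tensor product d_m is therefore, for large m, an exponential polynomial
   lambda^m (A_0 + m A_1 + ... + m^J A_J). An isomorphism intertwines these, which forces
   lambda_1 = lambda_2 and makes it commute with every A_j. The common kernel of the A_j with j >= 3
   is C[t] (x) V. There A_2 = -alpha F has the only eigenvalue -beta, with eigenspace 1 (x) V, which
   gives beta_1 = beta_2 and tau. The operators A_1 = G and A_0 = s determine the isomorphism
   from tau. *)
theory Submission
  imports Defs "HOL-Computational_Algebra.Fundamental_Theorem_Algebra"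
begin

subsection \<open>Finite-dimensional relations\<close>

text \<open>The polynomials g_n and the numbers b_n are forced. An intertwiner respects \<alpha> F =
  \<beta> (1 - d/dx), hence d/dx, so it sends the powers of h_1 to an Appell sequence: g_n' = n
  g_(n-1). This gives the binomial shape with b_n = g_n(0). On powers of x = h_1, G x^n = x^(n+1) +
  (\<beta> - n) x^n + \<eta>_1 n x^(n-1). The g_n must satisfy this relation, \<eta>_1 included, for
  the second G, which contains \<eta>_2; its constant term is the recurrence for b, with c =
  \<eta>_2 - \<eta>_1. The obstacle in V is that a commutator with d_m gives relations whose
  coefficients vary with the summation index. Comparing a combination with its shift by k leaves the
  constant coefficient 2 k. The combination exists because its coefficients range over an
  infinite-dimensional space and the conditions on them have finite rank. The resulting recurrence
  is solved for its lowest term and iterated. Different \<lambda> are impossible because then every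
  A_j would vanish, while A_0 is injective.\<close>

lemma (in vector_space) finite_span_generator:
  assumes "finite B" "S \<subseteq> span B"
  obtains C where "finite C" "C \<subseteq> S" "S \<subseteq> span C"
proof -
  obtain C where C: "C \<subseteq> S" "independent C" "S \<subseteq> span C"
    using maximal_independent_subset[of S] by blast
  have "finite C" using independent_span_bound[OF assms(1) C(2)] C(1) assms(2) by blast
  with C that show ?thesis by blast
qed

text \<open>Rank-nullity: preimages in \<open>P\<close> of finitely many generators of the image,
  together with generators of the kernel, span \<open>P\<close>.\<close>

lemma (in vector_space_pair) finite_span_if_finite_kernel:
  assumes L: "Vector_Spaces.linear s1 s2 L" and P: "vs1.subspace P"
    and im: "L ` P \<subseteq> vs2.span B" "finite B"
    and ker: "{x\<in>P. L x = 0} \<subseteq> vs1.span B'" "finite B'"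
  shows "\<exists>C. finite C \<and> P \<subseteq> vs1.span C"
proof -
  obtain C where C: "finite C" "C \<subseteq> L ` P" "L ` P \<subseteq> vs2.span C"
    using vs2.finite_span_generator[OF im(2,1)] .
  obtain C' where C': "finite C'" "C' \<subseteq> P" "C = L ` C'"
    using finite_subset_image[OF C(1,2)] by blast
  have "x \<in> vs1.span (C' \<union> B')" if x: "x \<in> P" for x
  proof -
    have "L x \<in> L ` vs1.span C'"
      using C(3) C'(3) x linear_span_image[OF L, of C'] by blast
    then obtain z where z: "z \<in> vs1.span C'" "L x = L z" by auto
    have "z \<in> P" using vs1.span_minimal[OF C'(2) P] z(1) by blast
    then have "x - z \<in> {x\<in>P. L x = 0}"
      using x z \<open>z \<in> P\<close> vs1.subspace_diff[OF P] linear_diff[OF L] by auto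
    then have "x - z \<in> vs1.span (C' \<union> B')"
      using ker(1) vs1.span_mono[of B' "C' \<union> B'"] by blast
    moreover have "z \<in> vs1.span (C' \<union> B')"
      using z(1) vs1.span_mono[of C' "C' \<union> B'"] by blast
    ultimately show ?thesis using vs1.span_add[of "x - z" _ z] by simp
  qed
  then show ?thesis using C'(1) ker(2) by (intro exI[of _ "C' \<union> B'"]) auto
qed

text \<open>A coordinate in a basis extending \<open>{y}\<close>. Such functionals reduce vector
  sequences to complex ones.\<close>

lemma (in vector_space) ex_separating_functional:
  assumes "y \<noteq> 0"
  shows "\<exists>l. (\<forall>x z. l (x + z) = l x + l z) \<and> (\<forall>a x. l (scale a x) = a * l x) \<and> l y \<noteq> 0"
proof -
  have ind: "independent {y}" using assms by simp
  define B where "B = extend_basis {y}"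
  have B: "independent B" "span B = UNIV" "y \<in> B"
    using independent_extend_basis[OF ind] span_extend_basis[OF ind] extend_basis_superset[OF ind]
    by (auto simp: B_def)
  have "representation B y y = 1" using representation_basis[OF B(1,3)] by simp
  then show ?thesis
    using representation_add[OF B(1)] representation_scale[OF B(1)] B(2)
    by (intro exI[of _ "\<lambda>x. representation B x y"]) auto
qed

section \<open>Infinite-dimensional spaces of coefficient polynomials\<close>

interpretation poly_vs: vector_space "smult :: complex \<Rightarrow> complex poly \<Rightarrow> complex poly"
  by unfold_locales (simp_all add: smult_add_left smult_add_right)

lemma complex_poly_not_finite_span:
  assumes "finite (B :: complex poly set)"
  shows "\<not> UNIV \<subseteq> poly_vs.span B"
proof
  assume *: "UNIV \<subseteq> poly_vs.span B"
  obtain d where d: "\<And>p. p \<in> B \<Longrightarrow> degree p \<le> d"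
    using assms finite_nat_set_iff_bounded_le[of "degree ` B"] by auto
  have "poly_vs.span B \<subseteq> {p. degree p \<le> d}"
    by (rule poly_vs.span_minimal)
      (auto simp: poly_vs.subspace_def d degree_add_le order.trans[OF degree_smult_le])
  then have "monom 1 (Suc d) \<in> {p :: complex poly. degree p \<le> d}" using * by blast
  then show False by (simp add: degree_monom_eq)
qed

text \<open>The linear map X^i \<mapsto> \<open>x i\<close>: a polynomial encodes a finite linear
  combination of the sequence, and multiplication by X shifts the sequence.\<close>

definition seq_comb :: "(complex \<Rightarrow> 'a::ab_group_add \<Rightarrow> 'a) \<Rightarrow> (nat \<Rightarrow> 'a) \<Rightarrow> complex poly \<Rightarrow> 'a" where
  "seq_comb sc x p = (\<Sum>i\<le>degree p. sc (coeff p i) (x i))"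

locale complex_vs = vector_space sc for sc :: "complex \<Rightarrow> 'v::ab_group_add \<Rightarrow> 'v"
begin

sublocale pair: vector_space_pair "smult :: complex \<Rightarrow> complex poly \<Rightarrow> complex poly" sc
  by unfold_locales

lemma seq_comb_eq:
  assumes "degree p \<le> n"
  shows "seq_comb sc x p = (\<Sum>i\<le>n. sc (coeff p i) (x i))"
  unfolding seq_comb_def
  by (rule sum.mono_neutral_left) (use assms in \<open>auto simp: coeff_eq_0\<close>)

lemma linear_seq_comb: "Vector_Spaces.linear smult sc (seq_comb sc x)"
proof (rule Vector_Spaces.linear_iff[THEN iffD2], intro conjI allI)
  show "vector_space (smult :: complex \<Rightarrow> complex poly \<Rightarrow> complex poly)" "vector_space sc"
    by unfold_locales
  fix p q :: "complex poly" and a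
  define n where "n = max (degree p) (degree q)"
  have "degree (p + q) \<le> n" "degree p \<le> n" "degree q \<le> n"
    by (auto simp: n_def degree_add_le_max)
  then show "seq_comb sc x (p + q) = seq_comb sc x p + seq_comb sc x q"
    by (simp add: seq_comb_eq[of _ n] scale_left_distrib sum.distrib)
  have "degree (smult a p) \<le> degree p" by (rule degree_smult_le)
  then show "seq_comb sc x (smult a p) = sc a (seq_comb sc x p)"
    by (simp add: seq_comb_eq[of _ "degree p"] scale_sum_right)
qed

lemma seq_comb_pCons: "seq_comb sc x (pCons a p) = sc a (x 0) + seq_comb sc (\<lambda>i. x (Suc i)) p"
  using seq_comb_eq[of "pCons a p" "Suc (degree p)" x] seq_comb_eq[of p "degree p" "\<lambda>i. x (Suc i)"]
  by (simp add: degree_pCons_le sum.atMost_Suc_shift del: sum.atMost_Suc)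

lemma seq_comb_0 [simp]: "seq_comb sc x 0 = 0" by (simp add: seq_comb_def)

lemma linear_seq_comb_shift: "Vector_Spaces.linear smult sc (\<lambda>p. seq_comb sc x (pCons 0 p))"
  using linear_seq_comb[of "\<lambda>i. x (Suc i)"] by (simp add: seq_comb_pCons)

lemma seq_comb_in_span:
  assumes "\<And>i. x i \<in> span B"
  shows "seq_comb sc x p \<in> span B"
  unfolding seq_comb_def by (intro span_sum span_scale assms)

text \<open>Infinite-dimensionality, a property that survives finitely many linear conditions of
  finite rank and still provides a nonzero polynomial at the end.\<close>

definition large :: "complex poly set \<Rightarrow> bool" where
  "large P \<longleftrightarrow> poly_vs.subspace P \<and> (\<forall>B. finite B \<longrightarrow> \<not> P \<subseteq> poly_vs.span B)"

lemma large_UNIV: "large UNIV"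
  using complex_poly_not_finite_span by (auto simp: large_def)

lemma large_ker:
  assumes "large P" "Vector_Spaces.linear smult sc L" "\<And>p. p \<in> P \<Longrightarrow> L p \<in> span B" "finite B"
  shows "large {p\<in>P. L p = 0}"
proof -
  have "poly_vs.subspace {p\<in>P. L p = 0}"
    using assms(1) pair.linear_0[OF assms(2)] pair.linear_add[OF assms(2)] pair.linear_scale[OF assms(2)]
    by (auto simp: large_def poly_vs.subspace_def)
  moreover have "\<not> {p\<in>P. L p = 0} \<subseteq> poly_vs.span B'" if "finite B'" for B'
    using assms(1,3,4) that pair.finite_span_if_finite_kernel[OF assms(2), of P B B']
    unfolding large_def by blast
  ultimately show ?thesis by (auto simp: large_def)
qed

lemma large_nonzero: "large P \<Longrightarrow> \<exists>p\<in>P. p \<noteq> 0"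
  using poly_vs.span_zero[of "{}"] by (force simp: large_def)

lemma ex_relation:
  assumes "\<And>i. x i \<in> span B" "finite B"
  shows "\<exists>p. p \<noteq> 0 \<and> seq_comb sc x p = 0"
  using large_nonzero[OF large_ker[OF large_UNIV linear_seq_comb[of x] seq_comb_in_span[OF assms(1)] assms(2)]]
  by auto

end

subsection \<open>Linear recurrences\<close>

lemma recurrence_exp_bound:
  fixes u :: "nat \<Rightarrow> complex"
  assumes p: "p \<noteq> 0" and rec: "\<And>r. (\<Sum>i\<le>degree p. coeff p i * u (r + i)) = 0"
  shows "\<exists>M C. M \<ge> 0 \<and> C \<ge> 0 \<and> (\<forall>r. cmod (u r) \<le> M * C ^ r)"
proof -
  define d where "d = degree p"
  define b where "b i = coeff p i / coeff p d" for i
  \<comment> \<open>One step of the recurrence multiplies the bound by at most \<open>C - 1\<close>;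
    the additional 1 makes the powers of \<open>C\<close> monotone.\<close>
  define C where "C = 1 + (\<Sum>i<d. cmod (b i))"
  define M where "M = (\<Sum>i\<le>d. cmod (u i))"
  have C1: "C \<ge> 1" unfolding C_def by (simp add: sum_nonneg)
  have M0: "M \<ge> 0" unfolding M_def by (simp add: sum_nonneg)
  have lc: "coeff p d \<noteq> 0" using p by (simp add: d_def)
  have u: "u (r + d) = - (\<Sum>i<d. b i * u (r + i))" for r
  proof -
    have "(\<Sum>i<d. coeff p i * u (r + i)) + coeff p d * u (r + d) = 0"
      using rec[of r] unfolding d_def[symmetric] by (metis lessThan_Suc_atMost sum.lessThan_Suc)
    then have "u (r + d) = - (\<Sum>i<d. coeff p i * u (r + i)) / coeff p d"
      using lc by (simp add: field_simps eq_neg_iff_add_eq_0)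
    then show ?thesis by (simp add: b_def sum_divide_distrib)
  qed
  have "cmod (u r) \<le> M * C ^ r" for r
  proof (induction r rule: less_induct)
    case (less r)
    show ?case
    proof (cases "r < d")
      case True
      then have "cmod (u r) \<le> M"
        unfolding M_def by (intro member_le_sum) auto
      also have "\<dots> \<le> M * C ^ r" using C1 M0 by (simp add: mult_le_cancel_left1)
      finally show ?thesis .
    next
      case False
      then obtain q where q: "r = q + d" using le_Suc_ex[of d r] by (auto simp: add.commute)
      have "cmod (u r) \<le> (\<Sum>i<d. cmod (b i) * cmod (u (q + i)))"
        unfolding q u norm_minus_cancel by (rule order.trans[OF norm_sum]) (simp add: norm_mult)
      also have "\<dots> \<le> (\<Sum>i<d. cmod (b i) * (M * C ^ (r - 1)))"
      proof (intro sum_mono mult_left_mono)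
        fix i assume i: "i \<in> {..<d}"
        have "cmod (u (q + i)) \<le> M * C ^ (q + i)" using less i q by auto
        also have "\<dots> \<le> M * C ^ (r - 1)"
          using C1 M0 i q by (intro mult_left_mono power_increasing) auto
        finally show "cmod (u (q + i)) \<le> M * C ^ (r - 1)" .
      qed auto
      also have "\<dots> = (C - 1) * (M * C ^ (r - 1))" by (simp add: C_def sum_distrib_right)
      also have "\<dots> \<le> M * C ^ r"
      proof (cases "r = 0")
        \<comment> \<open>Here d = 0, so \<open>C = 1\<close>.\<close>
        case True
        then show ?thesis using q M0 by (simp add: C_def)
      next
        case False
        then have "C ^ r = C * C ^ (r - 1)" by (cases r) auto
        then show ?thesis using C1 M0 by (simp add: algebra_simps)
      qed
      finally show ?thesis .
    qed
  qed
  then show ?thesis using C1 M0 by (meson order.trans zero_le_one)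
qed

text \<open>The recurrence can be run backwards, and then loses at most an exponential factor.\<close>
lemma recurrence_superexp_decay_zero:
  fixes w :: "nat \<Rightarrow> complex"
  assumes rec: "\<And>r. r \<ge> R \<Longrightarrow> w r = (\<Sum>i<d. a i * w (r + Suc i))"
    and decay: "\<And>q. q > 0 \<Longrightarrow> \<exists>D. \<forall>r. cmod (w r) \<le> D * q ^ r"
    and "r \<ge> R"
  shows "w r = 0"
proof -
  define A where "A = 1 + (\<Sum>i<d. cmod (a i))"
  have A1: "A \<ge> 1" by (simp add: A_def sum_nonneg)
  \<comment> \<open>Each backward step costs a factor \<open>A\<close> and moves at least one index
    further out, which gains \<open>q\<close>. This choice leaves a factor 1/2 per step.\<close>
  define q where "q = 1 / (2 * A)"
  have q: "q > 0" "q \<le> 1" "A * q = 1/2" using A1 by (auto simp: q_def)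
  obtain D where D: "\<And>r. cmod (w r) \<le> D * q ^ r" using decay[OF q(1)] by blast
  have D0: "D \<ge> 0" using order.trans[OF norm_ge_zero D[of 0]] by simp
  have *: "cmod (w r) \<le> A ^ n * D * q ^ (r + n)" if "r \<ge> R" for n r
    using that
  proof (induction n arbitrary: r)
    case 0
    then show ?case using D by simp
  next
    case (Suc n)
    have "cmod (w r) \<le> (\<Sum>i<d. cmod (a i) * cmod (w (r + Suc i)))"
      unfolding rec[OF Suc.prems] by (rule order.trans[OF norm_sum]) (simp add: norm_mult)
    also have "\<dots> \<le> (\<Sum>i<d. cmod (a i) * (A ^ n * D * q ^ (r + Suc n)))"
    proof (intro sum_mono mult_left_mono)
      fix i
      have "cmod (w (r + Suc i)) \<le> A ^ n * D * q ^ (r + Suc i + n)"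
        using Suc.IH[of "r + Suc i"] Suc.prems by simp
      also have "\<dots> \<le> A ^ n * D * q ^ (r + Suc n)"
        using q A1 D0 by (intro mult_left_mono power_decreasing mult_nonneg_nonneg) auto
      finally show "cmod (w (r + Suc i)) \<le> A ^ n * D * q ^ (r + Suc n)" .
    qed auto
    also have "\<dots> = (A - 1) * (A ^ n * D * q ^ (r + Suc n))" by (simp add: A_def sum_distrib_right)
    also have "\<dots> \<le> A * (A ^ n * D * q ^ (r + Suc n))"
      using q A1 D0 by (intro mult_right_mono mult_nonneg_nonneg) auto
    finally show ?case by (simp add: mult_ac)
  qed
  have "A ^ n * q ^ n = (1/2) ^ n" for n by (simp only: q(3) power_mult_distrib[symmetric])
  moreover have "A ^ n * D * q ^ (r + n) = (D * q ^ r) * (A ^ n * q ^ n)" for n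
    by (simp add: power_add mult_ac)
  ultimately have "cmod (w r) \<le> (D * q ^ r) * (1/2) ^ n" for n
    using *[OF assms(3), of n] by metis
  moreover have "(\<lambda>n. (D * q ^ r) * (1/2) ^ n) \<longlonglongrightarrow> (D * q ^ r) * 0"
    by (intro tendsto_mult tendsto_const LIMSEQ_power_zero) auto
  ultimately have "cmod (w r) \<le> (D * q ^ r) * 0"
    using LIMSEQ_le_const by blast
  then show ?thesis by simp
qed

lemma power_over_fact_bounded:
  fixes x :: real
  shows "\<exists>K. \<forall>n. \<bar>x ^ n / fact n\<bar> \<le> K"
proof -
  have "summable (\<lambda>n. x ^ n / fact n)"
    using summable_exp[of x] by (simp add: field_simps)
  then have "(\<lambda>n. x ^ n / fact n) \<longlonglongrightarrow> 0" by (rule summable_LIMSEQ_zero)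
  then have "Bseq (\<lambda>n. x ^ n / fact n)" by (intro convergent_imp_Bseq convergentI)
  then show ?thesis by (auto simp: Bseq_def)
qed

text \<open>Exponential growth divided by factorial growth is O(q^r) for every positive q. The
  factor \<open>c\<close> will be the product that relates (d_k - a)^r d_j v to d_(j+rk) v.\<close>

lemma factorial_quotient_decay:
  fixes w u c :: "nat \<Rightarrow> complex"
  assumes "\<And>r. cmod (u r) \<le> M * C ^ r" "M \<ge> 0" "C \<ge> 0"
    and "\<And>r. u r = c r * w r" "\<And>r. cmod (c r) \<ge> fact r" and "q > 0"
  shows "\<exists>D. \<forall>r. cmod (w r) \<le> D * q ^ r"
proof -
  obtain K where K: "\<And>n. \<bar>(C / q) ^ n / fact n\<bar> \<le> K" using power_over_fact_bounded by blast
  have "cmod (w r) \<le> M * K * q ^ r" for r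
  proof -
    have "fact r * cmod (w r) \<le> cmod (c r) * cmod (w r)"
      using assms(5) by (intro mult_right_mono) auto
    also have "\<dots> \<le> M * C ^ r" using assms(1,4)[of r] by (simp add: norm_mult)
    finally have "cmod (w r) \<le> M * (C ^ r / fact r)" by (simp add: field_simps)
    also have "\<dots> = M * (((C / q) ^ r / fact r) * q ^ r)" using \<open>q > 0\<close> by (simp add: power_divide)
    also have "\<dots> \<le> M * (K * q ^ r)"
      using K[of r] assms by (intro mult_left_mono mult_right_mono) auto
    finally show ?thesis by (simp add: mult_ac)
  qed
  then show ?thesis by blast
qed

subsection \<open>Eventual annihilation\<close>

context complex_vs
begin

lemma seq_comb_add: "seq_comb sc (\<lambda>i. x i + z i) p = seq_comb sc x p + seq_comb sc z p"
  by (simp add: seq_comb_def scale_right_distrib sum.distrib)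

lemma seq_comb_scale: "seq_comb sc (\<lambda>i. sc a (x i)) p = sc a (seq_comb sc x p)"
  by (simp add: seq_comb_def scale_sum_right mult.commute)

lemma seq_comb_diff: "seq_comb sc (\<lambda>i. x i - z i) p = seq_comb sc x p - seq_comb sc z p"
  by (simp add: seq_comb_def scale_right_diff_distrib sum_subtractf)

lemma seq_comb_image:
  assumes add: "\<And>x z. T (x + z) = T x + T z" and scale: "\<And>a x. T (sc a x) = sc a (T x)"
  shows "T (seq_comb sc x p) = seq_comb sc (\<lambda>i. T (x i)) p"
proof -
  have "T 0 = 0" using scale[of 0 0] by simp
  then have "T (sum f A) = (\<Sum>i\<in>A. T (f i))" for f and A :: "nat set"
    by (induction A rule: infinite_finite_induct) (simp_all add: add)
  then show ?thesis by (simp add: seq_comb_def scale)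
qed

lemma functional_seq_comb:
  assumes add: "\<And>x z. l (x + z) = l x + l z" and scale: "\<And>a x. l (sc a x) = a * l x"
  shows "l (seq_comb sc x p) = (\<Sum>i\<le>degree p. coeff p i * l (x i))"
proof -
  have "l 0 = 0" using scale[of 0 0] by simp
  then have "l (sum f A) = (\<Sum>i\<in>A. l (f i))" for f and A :: "nat set"
    by (induction A rule: infinite_finite_induct) (simp_all add: add)
  then show ?thesis by (simp add: seq_comb_def scale)
qed

text \<open>Over the complex numbers p has a factor X - a. The vector (T - a) v is killed by the
  cofactor, of smaller degree; if it is zero, v itself is an eigenvector.\<close>

lemma ex_eigenvector_of_relation:
  assumes add: "\<And>x z. T (x + z) = T x + T z" and scale: "\<And>a x. T (sc a x) = sc a (T x)"
  shows "p \<noteq> 0 \<Longrightarrow> seq_comb sc (\<lambda>n. (T ^^ n) v) p = 0 \<Longrightarrow> v \<noteq> 0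
    \<Longrightarrow> \<exists>w a. w \<noteq> 0 \<and> T w = sc a w"
proof (induction "degree p" arbitrary: p v rule: less_induct)
  case less
  show ?case
  proof (cases "degree p = 0")
    case True
    then obtain c where "p = [:c:]" by (rule degree_eq_zeroE)
    with less.prems show ?thesis by (simp add: seq_comb_pCons)
  next
    case False
    then obtain a where "poly p a = 0"
      using fundamental_theorem_of_algebra[of p] constant_degree[of p] by auto
    then obtain q where q: "p = [:-a, 1:] * q" by (auto simp: poly_eq_0_iff_dvd dvd_def)
    have q0: "q \<noteq> 0" using less.prems(1) q by auto
    then have deg: "degree q < degree p" unfolding q by (subst degree_mult_eq) auto
    define w where "w = T v - sc a v"
    have minus: "T (x - z) = T x - T z" for x z using add[of "x - z" z] by (simp add: algebra_simps)
    have Tn: "(T ^^ n) w = (T ^^ Suc n) v - sc a ((T ^^ n) v)" for n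
    proof (induction n)
      case (Suc n)
      then show ?case by (simp add: minus scale)
    qed (simp add: w_def)
    have "seq_comb sc (\<lambda>n. (T ^^ n) w) q
        = seq_comb sc (\<lambda>n. (T ^^ n) v) (pCons 0 q) - sc a (seq_comb sc (\<lambda>n. (T ^^ n) v) q)"
      by (simp add: Tn seq_comb_diff seq_comb_scale seq_comb_pCons)
    also have "\<dots> = seq_comb sc (\<lambda>n. (T ^^ n) v) (pCons 0 q - smult a q)"
      using pair.linear_diff[OF linear_seq_comb] pair.linear_scale[OF linear_seq_comb] by simp
    also have "pCons 0 q - smult a q = p" by (simp add: q)
    finally have "seq_comb sc (\<lambda>n. (T ^^ n) w) q = 0" using less.prems by simp
    then show ?thesis
      using less.hyps[OF deg q0, of w] by (cases "w = 0") (use less.prems(3) in \<open>auto simp: w_def\<close>)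
  qed
qed

end

text \<open>The bracket relation is asked for i + j \<noteq> 0, where the central term is absent, so
  that \<open>C\<close> can be left out.\<close>

locale witt_rep = complex_vs sc for sc :: "complex \<Rightarrow> 'v::ab_group_add \<Rightarrow> 'v" +
  fixes D :: "int \<Rightarrow> 'v \<Rightarrow> 'v"
  assumes D_add: "D m (x + z) = D m x + D m z"
    and D_scale: "D m (sc a x) = sc a (D m x)"
    and D_comm: "i + j \<noteq> 0 \<Longrightarrow> D i (D j x) - D j (D i x) = sc (of_int (j - i)) (D (i + j) x)"
begin

lemma D_0 [simp]: "D m 0 = 0"
  using D_scale[of m 0 0] by simp

lemma shift_relation:
  fixes k :: int
  assumes k: "k \<ge> 1" and v: "D k v = sc a v"
    and B: "finite B" "\<And>i. i > k \<Longrightarrow> D i v \<in> span B"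
  shows "\<exists>f M0. f \<noteq> 0 \<and> (\<forall>M\<ge>M0. seq_comb sc (\<lambda>i. D (M + int i * k) v) f = 0)"
proof -
  \<comment> \<open>All indices exceed k, where \<open>B\<close> controls \<open>D i v\<close>, and
    they advance by k, so that \<open>pCons 0 f\<close> raises each index by k.\<close>
  define E where "E f x = seq_comb sc (\<lambda>i. D (k + 1 + int i * k) x) f" for f x
  have E_add: "E f (x + z) = E f x + E f z" for f x z by (simp add: E_def D_add seq_comb_add)
  have E_scale: "E f (sc b x) = sc b (E f x)" for f x b by (simp add: E_def D_scale seq_comb_scale)
  have lin1: "Vector_Spaces.linear smult sc (\<lambda>f. E f x)" for x
    using linear_seq_comb by (simp add: E_def)
  have lin2: "Vector_Spaces.linear smult sc (\<lambda>f. E (pCons 0 f) x)" for x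
    using linear_seq_comb_shift by (simp add: E_def)
  have pos: "k + 1 + int i * k > k" for i using k by (simp add: add_strict_increasing)
  have Ev: "E f v \<in> span B" for f
    unfolding E_def by (intro seq_comb_in_span B pos)
  have ED: "E f (D m v) = D m (E f v)
      + seq_comb sc (\<lambda>i. sc (of_int (m - (k + 1 + int i * k))) (D (m + (k + 1 + int i * k)) v)) f"
    if "m > k" for f m
  proof -
    have "D (k + 1 + int i * k) (D m v) = D m (D (k + 1 + int i * k) v)
        + sc (of_int (m - (k + 1 + int i * k))) (D (m + (k + 1 + int i * k)) v)" for i
      using D_comm[of "k + 1 + int i * k" m v] pos[of i] that k
      by (simp add: algebra_simps)
    then show ?thesis
      by (simp add: E_def seq_comb_add seq_comb_image[where T = "D m", OF D_add D_scale])
  qed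
  have EDspan: "E f (D m v) \<in> span B" if "E f v = 0" "m > k" for f m
    unfolding ED[OF that(2)] that(1) using that(2) k
    by (auto intro!: seq_comb_in_span span_scale B simp: add_pos_pos add_strict_increasing)
  \<comment> \<open>These two conditions come first: by \<open>ED\<close>, the vector
    \<open>E f (D m v)\<close> stays in the span of \<open>B\<close> once \<open>E f v = 0\<close>,
    so the later conditions have finite rank as well.\<close>
  define P where "P = {f \<in> {f \<in> UNIV. E f v = 0}. E (pCons 0 f) v = 0}"
  have P: "large P"
    unfolding P_def by (intro large_ker[OF _ lin2 _ B(1)] large_ker[OF _ lin1 _ B(1)] large_UNIV Ev)
  \<comment> \<open>The generators are chosen among the vectors \<open>D m v\<close> themselves, so
    that \<open>EDspan\<close> applies to each of them.\<close>
  obtain I where I: "finite I" "I \<subseteq> (\<lambda>m. D m v) ` {k<..}" "(\<lambda>m. D m v) ` {k<..} \<subseteq> span I"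
    using finite_span_generator[OF B(1), of "(\<lambda>m. D m v) ` {k<..}"] B(2) by auto
  from I(1,2) have "large {f \<in> P. \<forall>x\<in>I. E f x = 0 \<and> E (pCons 0 f) x = 0}"
  proof (induction I rule: finite_induct)
    case empty
    then show ?case using P by simp
  next
    case (insert x I)
    then obtain m where m: "m > k" "x = D m v" by auto
    let ?Q = "{f \<in> P. \<forall>x\<in>I. E f x = 0 \<and> E (pCons 0 f) x = 0}"
    have "large {f \<in> {f \<in> ?Q. E f x = 0}. E (pCons 0 f) x = 0}"
      unfolding m(2)
      by (intro large_ker[OF _ lin2 _ B(1)] large_ker[OF _ lin1 _ B(1)] EDspan m(1))
        (use insert in \<open>auto simp: P_def\<close>)
    then show ?case by (rule back_subst[of large]) auto
  qed
  then obtain f where f: "f \<noteq> 0" "f \<in> P" "\<And>x. x \<in> I \<Longrightarrow> E f x = 0"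
    "\<And>x. x \<in> I \<Longrightarrow> E (pCons 0 f) x = 0"
    using large_nonzero by blast
  have ker: "E g (D m v) = 0" if "\<And>x. x \<in> I \<Longrightarrow> E g x = 0" "m > k" for g m
  proof -
    have "subspace {x. E g x = 0}"
      using E_scale[of g 0 0] by (auto simp: subspace_def E_add E_scale)
    then have "span I \<subseteq> {x. E g x = 0}" using that(1) by (intro span_minimal) auto
    then show ?thesis using I(3) that(2) by auto
  qed
  have "seq_comb sc (\<lambda>i. D (M + int i * k) v) f = 0" if M: "M \<ge> 3 * k + 3" for M
  proof -
    \<comment> \<open>With this m, both \<open>f\<close> at m + k and \<open>pCons 0 f\<close> at m
      involve exactly the vectors \<open>D (M + i k) v\<close>. The bound on M gives m > k.\<close>
    define m where "m = M - 2 * k - 1"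
    have m: "m > k" using M by (simp add: m_def)
    have "seq_comb sc (\<lambda>i. sc (of_int (m + k - (k + 1 + int i * k))) (D (M + int i * k) v)) f = 0"
      using ker[OF f(3), of "m + k"] ED[of "m + k" f] m k f(2)
      by (simp add: P_def m_def algebra_simps)
    moreover have "seq_comb sc (\<lambda>i. sc (of_int (m - (2 * k + 1 + int i * k))) (D (M + int i * k) v)) f = 0"
    proof -
      have idx: "m - (k + 1 + int (Suc i) * k) = m - (2 * k + 1 + int i * k)"
        "m + (k + 1 + int (Suc i) * k) = M + int i * k" for i
        by (simp_all add: m_def algebra_simps)
      have "seq_comb sc (\<lambda>i. sc (of_int (m - (k + 1 + int (Suc i) * k)))
          (D (m + (k + 1 + int (Suc i) * k)) v)) f = 0"
        using ker[OF f(4), of m] ED[of m "pCons 0 f"] m f(2)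
        by (simp add: P_def seq_comb_pCons del: of_nat_Suc of_int_diff of_int_add)
      then show ?thesis by (simp only: idx)
    qed
    text \<open>The difference of the two relations has the constant coefficient \<open>2 k\<close>.\<close>
    ultimately have "seq_comb sc (\<lambda>i. sc (of_int (m + k - (k + 1 + int i * k))) (D (M + int i * k) v)
        - sc (of_int (m - (2 * k + 1 + int i * k))) (D (M + int i * k) v)) f = 0"
      by (simp only: seq_comb_diff) simp
    then have "seq_comb sc (\<lambda>i. sc (of_int (2 * k)) (D (M + int i * k) v)) f = 0"
      by (simp add: scale_left_diff_distrib[symmetric] algebra_simps)
    then show ?thesis using k by (simp add: seq_comb_scale)
  qed
  with f(1) show ?thesis by blast
qed

text \<open>Dropping the factors X of f makes the constant coefficient nonzero, so that
  \<open>D M v\<close> can be expressed through later vectors.\<close>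

lemma shift_recurrence:
  fixes k :: int
  assumes k: "k \<ge> 1" and f: "f \<noteq> 0" "\<And>M. M \<ge> M0 \<Longrightarrow> seq_comb sc (\<lambda>i. D (M + int i * k) v) f = 0"
  shows "\<exists>a g M1. a \<noteq> 0 \<and> (\<forall>M\<ge>M1. sc a (D M v) + seq_comb sc (\<lambda>i. D (M + int (Suc i) * k) v) g = 0)"
  using f
proof (induction f arbitrary: M0)
  case 0
  then show ?case by simp
next
  case (pCons a f)
  have *: "sc a (D M v) + seq_comb sc (\<lambda>i. D (M + int (Suc i) * k) v) f = 0" if "M \<ge> M0" for M
    using pCons.prems(2)[OF that] by (simp add: seq_comb_pCons)
  show ?case
  proof (cases "a = 0")
    case True
    have "seq_comb sc (\<lambda>i. D (M + int i * k) v) f = 0" if "M \<ge> M0 + k" for M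
      using *[of "M - k"] True that by (simp add: algebra_simps)
    then show ?thesis using pCons.IH pCons.hyps True by blast
  next
    case False
    then show ?thesis using * by blast
  qed
qed

lemma eigenvector_eventually_annihilated:
  fixes k :: int
  assumes k: "k \<ge> 1" and v: "D k v = sc a v"
    and fin: "\<And>x. \<exists>B. finite B \<and> (\<forall>n. (D k ^^ n) x \<in> span B)"
  shows "\<exists>N. \<forall>n\<ge>N. D n v = 0"
proof -
  define T where "T x = D k x - sc a x" for x
  have T_add: "T (x + z) = T x + T z" and T_scale: "T (sc b x) = sc b (T x)" for x z b
    by (simp_all add: T_def D_add D_scale scale_right_distrib scale_right_diff_distrib mult.commute)
  have T_pow: "(T ^^ n) (x + z) = (T ^^ n) x + (T ^^ n) z" "(T ^^ n) (sc b x) = sc b ((T ^^ n) x)" for n x z b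
    by (induction n) (simp_all add: T_add T_scale)
  have T_D: "T (D i v) = sc (of_int (i - k)) (D (i + k) v)" if "i > k" for i
    using D_comm[of k i v] that k by (simp add: T_def v D_scale algebra_simps)
  \<comment> \<open>The factors collected by applying \<open>T_D\<close> along j, j + k, j + 2k,
    ...; the one for u is at least u + 1, because j > k and k \<ge> 1.\<close>
  define c :: "int \<Rightarrow> nat \<Rightarrow> complex" where "c j r = (\<Prod>u<r. of_int (j - k + int u * k))" for j r
  have T_pow_D: "(T ^^ r) (D j v) = sc (c j r) (D (j + int r * k) v)" if "j > k" for j r
  proof (induction r)
    case (Suc r)
    have "int r * k \<ge> 0" using k by simp
    then have "j + int r * k > k" using that by linarith
    with Suc show ?case by (simp add: c_def T_scale T_D algebra_simps)
  qed (simp add: c_def)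
  have c_ge: "cmod (c j r) \<ge> fact r" if "j > k" for j r
  proof -
    have "(fact r :: real) = (\<Prod>u<r. of_nat (Suc u))" by (simp add: fact_prod_Suc atLeast0LessThan)
    also have "\<dots> \<le> (\<Prod>u<r. cmod (of_int (j - k + int u * k)))"
    proof (intro prod_mono conjI)
      fix u
      have "int u * 1 \<le> int u * k" using k by (intro mult_left_mono) auto
      then have "int (Suc u) \<le> \<bar>j - k + int u * k\<bar>" using that by linarith
      then have "real_of_int (int (Suc u)) \<le> real_of_int \<bar>j - k + int u * k\<bar>" by (simp only: of_int_le_iff)
      then show "real (Suc u) \<le> cmod (of_int (j - k + int u * k))" by (simp only: norm_of_int of_int_of_nat_eq of_int_abs)
    qed auto
    finally show ?thesis by (simp add: c_def prod_norm)
  qed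
  have c_nz: "c j r \<noteq> 0" if "j > k" for j r
    using c_ge[OF that, of r] by (metis fact_gt_zero norm_zero not_le)
  \<comment> \<open>The span of the \<open>D k\<close>-orbit of x is stable under
    \<open>D k\<close>, hence under \<open>T\<close>.\<close>
  have T_span: "(T ^^ r) x \<in> span B" if "\<And>n. (D k ^^ n) x \<in> span B" for r x B
  proof -
    define U where "U = span (range (\<lambda>n. (D k ^^ n) x))"
    have DU: "D k z \<in> U" if "z \<in> U" for z
    proof -
      have sub: "subspace {z. D k z \<in> U}"
        unfolding U_def by (auto simp: subspace_def D_add D_scale intro: span_add span_scale span_zero)
      have "D k ((D k ^^ n) x) \<in> U" for n
        unfolding U_def by (rule span_base) (metis funpow.simps(2) o_apply rangeI)
      then have "U \<subseteq> {z. D k z \<in> U}"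
        using sub unfolding U_def by (intro span_minimal) auto
      with that show ?thesis by auto
    qed
    have "(T ^^ r) x \<in> U"
    proof (induction r)
      case 0
      have "(D k ^^ 0) x \<in> U" unfolding U_def by (intro span_base rangeI)
      then show ?case by simp
    next
      case (Suc r)
      then show ?case using DU by (auto simp: T_def U_def intro: span_diff span_scale)
    qed
    moreover have "U \<subseteq> span B" unfolding U_def using that by (intro span_minimal) auto
    ultimately show ?thesis by blast
  qed
  obtain Bf where Bf: "\<And>x. finite (Bf x)" "\<And>x n. (D k ^^ n) x \<in> span (Bf x)"
    using fin by metis
  have residue: "\<exists>j r. k < j \<and> j \<le> 2 * k \<and> i = j + int r * k" if "i > k" for i
  proof (intro exI conjI)
    show "i = (k + 1 + (i - k - 1) mod k) + int (nat ((i - k - 1) div k)) * k"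
      using that k div_mult_mod_eq[of "i - k - 1" k] by (simp add: pos_imp_zdiv_nonneg_iff)
    show "k < k + 1 + (i - k - 1) mod k" using pos_mod_sign[of k "i - k - 1"] k by linarith
    show "k + 1 + (i - k - 1) mod k \<le> 2 * k" using pos_mod_bound[of k "i - k - 1"] k by linarith
  qed
  \<comment> \<open>\<open>T ^^ r\<close> maps \<open>D j v\<close> to a nonzero multiple of
    \<open>D (j + r k) v\<close>, so the \<open>T\<close>-orbits of the k vectors with k < j \<le>
    2k reach every \<open>D i v\<close> with i > k, up to scalars.\<close>
  define B where "B = (\<Union>j\<in>{k<..2 * k}. Bf (D j v))"
  have B: "finite B" using Bf(1) by (simp add: B_def)
  have DB: "D i v \<in> span B" if i: "i > k" for i
  proof -
    obtain j r where j: "k < j" "j \<le> 2 * k" "i = j + int r * k" using residue[OF i] by blast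
    have "(T ^^ r) (D j v) \<in> span B"
      by (rule T_span, rule subsetD[OF span_mono Bf(2)]) (use j in \<open>auto simp: B_def\<close>)
    then have "sc (1 / c j r) ((T ^^ r) (D j v)) \<in> span B" by (rule span_scale)
    then show ?thesis using c_nz[OF j(1), of r] by (simp add: T_pow_D[OF j(1)] j(3))
  qed
  obtain f M0 where "f \<noteq> 0" "\<And>M. M \<ge> M0 \<Longrightarrow> seq_comb sc (\<lambda>i. D (M + int i * k) v) f = 0"
    using shift_relation[OF k v B DB] by blast
  then obtain b g M1 where b: "b \<noteq> 0"
    and g: "\<And>M. M \<ge> M1 \<Longrightarrow> sc b (D M v) + seq_comb sc (\<lambda>i. D (M + int (Suc i) * k) v) g = 0"
    using shift_recurrence[OF k] by metis
  have "D n v = 0" if n: "n \<ge> max M1 (k + 1)" for n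
  proof (rule ccontr)
    assume "D n v \<noteq> 0"
    then obtain l where l: "\<And>x z. l (x + z) = l x + l z" "\<And>a x. l (sc a x) = a * l x" "l (D n v) \<noteq> 0"
      using ex_separating_functional by metis
    obtain j r where j: "k < j" "n = j + int r * k" using residue[of n] n by auto
    define u where "u s = l ((T ^^ s) (D j v))" for s
    define w where "w s = l (D (j + int s * k) v)" for s
    \<comment> \<open>A relation in the \<open>T\<close>-orbit of \<open>D j v\<close> is a linear
      recurrence for \<open>u\<close>, which therefore grows at most exponentially.\<close>
    obtain p where p: "p \<noteq> 0" "seq_comb sc (\<lambda>s. (T ^^ s) (D j v)) p = 0"
      using ex_relation[of "\<lambda>s. (T ^^ s) (D j v)", OF T_span[OF Bf(2)] Bf(1)] by blast
    have "(\<Sum>i\<le>degree p. coeff p i * u (s + i)) = l ((T ^^ s) (seq_comb sc (\<lambda>s. (T ^^ s) (D j v)) p))" for s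
      by (simp add: seq_comb_image[where T = "T ^^ s", OF T_pow] functional_seq_comb[OF l(1,2)] u_def funpow_add)
    also have "\<dots> s = 0" for s
      using p(2) T_pow(2)[of s 0 0] l(2)[of 0 0] by simp
    finally obtain K C where KC: "K \<ge> 0" "C \<ge> 0" "\<And>s. cmod (u s) \<le> K * C ^ s"
      using recurrence_exp_bound[OF p(1), of u] by blast
    have dec: "\<exists>E. \<forall>s. cmod (w s) \<le> E * q ^ s" if "q > 0" for q
      by (rule factorial_quotient_decay[OF KC(3,1,2) _ c_ge[OF j(1)] that])
        (simp add: u_def w_def T_pow_D[OF j(1)] l)
    \<comment> \<open>The fact \<open>g\<close> at M = j + s k, solved for \<open>w s\<close>; s
      \<ge> r ensures M \<ge> n \<ge> \<open>M1\<close>.\<close>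
    have "w s = (\<Sum>i<Suc (degree g). (- coeff g i / b) * w (s + Suc i))" if "s \<ge> r" for s
    proof -
      have "j + int s * k \<ge> M1"
        using n j(2) mult_right_mono[of "int r" "int s" k] that k by linarith
      then have "l (sc b (D (j + int s * k) v)
          + seq_comb sc (\<lambda>i. D (j + int s * k + int (Suc i) * k) v) g) = 0"
        using g l(2)[of 0 0] by simp
      then have "b * w s + (\<Sum>i\<le>degree g. coeff g i * w (s + Suc i)) = 0"
        by (simp add: l functional_seq_comb[OF l(1,2)] w_def algebra_simps)
      then have "w s = - (\<Sum>i\<le>degree g. coeff g i * w (s + Suc i)) / b"
        using b by (simp add: field_simps eq_neg_iff_add_eq_0)
      also have "\<dots> = (\<Sum>i\<le>degree g. (- coeff g i / b) * w (s + Suc i))"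
        by (simp add: sum_negf[symmetric] sum_divide_distrib)
      finally show ?thesis by (simp only: lessThan_Suc_atMost)
    qed
    from recurrence_superexp_decay_zero[of r, OF this dec order.refl]
    have "w r = 0" .
    then show False using l(3) j(2) by (simp add: w_def)
  qed
  then show ?thesis by blast
qed

end

lemma irreducible_eventually_annihilated:
  assumes irr: "vir_irreducible sc UNIV D C" and k: "k \<ge> 1"
    and fin: "locally_finite_op sc UNIV (D k)"
  shows "\<exists>N. \<forall>n\<ge>N. D n v = 0"
proof -
  have mod: "vir_module sc UNIV D C" and ne: "(UNIV :: 'a set) \<noteq> {0}"
    and sub: "\<And>N. vir_submodule sc UNIV D C N \<Longrightarrow> N = {0} \<or> N = UNIV"
    using irr by (auto simp: vir_irreducible_def)
  interpret vector_space sc using mod by (simp add: vir_module_def)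
  interpret witt_rep sc D
    using mod by unfold_locales (auto simp: vir_module_def)
  obtain x :: 'a where x: "x \<noteq> 0" using ne by auto
  have fin': "\<exists>B. finite B \<and> (\<forall>n. (D k ^^ n) x \<in> span B)" for x
    using fin by (auto simp: locally_finite_op_def)
  obtain B where "finite B" "\<And>n. (D k ^^ n) x \<in> span B" using fin' by blast
  then obtain p where "p \<noteq> 0" "seq_comb sc (\<lambda>n. (D k ^^ n) x) p = 0"
    using ex_relation[of "\<lambda>n. (D k ^^ n) x" B] by blast
  then obtain w a where w: "w \<noteq> 0" "D k w = sc a w"
    using ex_eigenvector_of_relation[where T = "D k", OF D_add D_scale] x by blast
  define N where "N = {v. \<exists>N. \<forall>n\<ge>N. D n v = 0}"
  have "w \<in> N"
    using eigenvector_eventually_annihilated[OF k w(2) fin'] by (simp add: N_def)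
  have "vir_submodule sc UNIV D C N"
    unfolding vir_submodule_def
  proof (intro conjI ballI allI)
    show "0 \<in> N" by (simp add: N_def)
    show "x + z \<in> N" if xz: "x \<in> N" "z \<in> N" for x z
    proof -
      obtain a b where "\<forall>n\<ge>a. D n x = 0" "\<forall>n\<ge>b. D n z = 0" using xz by (auto simp: N_def)
      then have "\<forall>n\<ge>max a b. D n (x + z) = 0" by (simp add: D_add)
      then show ?thesis unfolding N_def by blast
    qed
    show "sc b x \<in> N" if "x \<in> N" for b x
      using that by (auto simp: N_def D_scale)
    show "D m x \<in> N" if xN: "x \<in> N" for m x
    proof -
      obtain a where a: "\<And>n. n \<ge> a \<Longrightarrow> D n x = 0" using xN by (auto simp: N_def)
      \<comment> \<open>The bound keeps n and n + m above a, and n + m positive so that no central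
        term appears.\<close>
      have "D n (D m x) = 0" if "n \<ge> max (max a (a - m)) (1 - m)" for n
        using D_comm[of n m x] a[of n] a[of "n + m"] that by simp
      then show ?thesis unfolding N_def by blast
    qed
    show "C x \<in> N" if "x \<in> N" for x
    proof -
      have "D i (C x) = C (D i x)" and C_sc: "C (sc a z) = sc a (C z)" for i a z
        using mod by (simp_all add: vir_module_def)
      moreover have "C 0 = 0" using C_sc[of 0 0] by simp
      ultimately show ?thesis using that by (fastforce simp: N_def)
    qed
  qed auto
  then have "N = UNIV" using sub w(1) \<open>w \<in> N\<close> by blast
  then show ?thesis by (auto simp: N_def)
qed

subsection \<open>Tensor products\<close>

lemma sum_fun_apply: "(\<Sum>i\<in>A. f i) x = (\<Sum>i\<in>A. f i x)"
  by (induction A rule: infinite_finite_induct) auto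

text \<open>Linearity over the complex numbers: in this encoding the scalars of C[t,s] are
  polynomials in t, over which F and G are not linear, so a complex scalar is written
  \<open>[:a:]\<close>.\<close>

definition poly_linear :: "(complex poly poly \<Rightarrow> complex poly poly) \<Rightarrow> bool" where
  "poly_linear \<Phi> \<longleftrightarrow> (\<forall>P Q. \<Phi> (P + Q) = \<Phi> P + \<Phi> Q) \<and> (\<forall>a P. \<Phi> (smult [:a:] P) = smult [:a:] (\<Phi> P))"

lemma poly_linearI:
  assumes "\<And>P Q. \<Phi> (P + Q) = \<Phi> P + \<Phi> Q" "\<And>a P. \<Phi> (smult [:a:] P) = smult [:a:] (\<Phi> P)"
  shows "poly_linear \<Phi>"
  using assms by (simp add: poly_linear_def)

lemma poly_linear_add: "poly_linear \<Phi> \<Longrightarrow> \<Phi> (P + Q) = \<Phi> P + \<Phi> Q"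
  and poly_linear_smult: "poly_linear \<Phi> \<Longrightarrow> \<Phi> (smult [:a:] P) = smult [:a:] (\<Phi> P)"
  by (simp_all add: poly_linear_def)

lemma poly_linear_0: "poly_linear \<Phi> \<Longrightarrow> \<Phi> 0 = 0"
  using poly_linear_smult[of \<Phi> 0 0] by simp

lemma poly_linear_sum: "poly_linear \<Phi> \<Longrightarrow> \<Phi> (sum f A) = (\<Sum>i\<in>A. \<Phi> (f i))"
  by (induction A rule: infinite_finite_induct) (auto simp: poly_linear_0 poly_linear_add)

lemma poly_linear_comp: "poly_linear \<Phi> \<Longrightarrow> poly_linear \<Psi> \<Longrightarrow> poly_linear (\<lambda>P. \<Phi> (\<Psi> P))"
  by (simp add: poly_linear_def)

abbreviation bmonom :: "nat \<times> nat \<Rightarrow> complex poly poly" where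
  "bmonom k \<equiv> monom (monom 1 (fst k)) (snd k)"

abbreviation coeff2 :: "complex poly poly \<Rightarrow> nat \<times> nat \<Rightarrow> complex" where
  "coeff2 P k \<equiv> coeff (coeff P (snd k)) (fst k)"

lemma coeff2_mono: "coeff2 (bmonom l) k = (if k = l then 1 else 0)"
  by (auto simp: prod_eq_iff)

lemma finite_coeff2: "finite {k. coeff2 P k \<noteq> 0}"
proof (rule finite_subset)
  show "{k. coeff2 P k \<noteq> 0} \<subseteq> (\<Union>i\<le>degree P. {..degree (coeff P i)} \<times> {i})"
    by (fastforce intro: le_degree)
qed auto

lemma mono_decomp:
  assumes "finite S" "{k. coeff2 P k \<noteq> 0} \<subseteq> S"
  shows "P = (\<Sum>k\<in>S. smult [:coeff2 P k:] (bmonom k))"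
proof (intro poly_eqI)
  fix i a
  have "coeff2 (\<Sum>k\<in>S. smult [:coeff2 P k:] (bmonom k)) (a, i)
      = (\<Sum>k\<in>S. coeff2 P k * coeff2 (bmonom k) (a, i))"
    by (simp add: coeff_sum del: coeff_monom)
  also have "\<dots> = (\<Sum>k\<in>S. if (a, i) = k then coeff2 P (a, i) else 0)"
    by (intro sum.cong refl) (auto simp: coeff2_mono prod_eq_iff)
  also have "\<dots> = coeff2 P (a, i)"
    using assms by (subst sum.delta') force+
  finally show "coeff (coeff P i) a = coeff (coeff (\<Sum>k\<in>S. smult [:coeff2 P k:] (bmonom k)) i) a"
    by simp
qed

lemma poly_linear_eqI:
  assumes "poly_linear \<Phi>" "poly_linear \<Psi>" "\<And>k. \<Phi> (bmonom k) = \<Psi> (bmonom k)"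
  shows "\<Phi> P = \<Psi> P"
proof -
  let ?S = "{k. coeff2 P k \<noteq> 0}"
  have "\<Phi> (\<Sum>k\<in>?S. smult [:coeff2 P k:] (bmonom k)) = \<Psi> (\<Sum>k\<in>?S. smult [:coeff2 P k:] (bmonom k))"
    by (simp only: poly_linear_sum[OF assms(1)] poly_linear_sum[OF assms(2)]
        poly_linear_smult[OF assms(1)] poly_linear_smult[OF assms(2)] assms(3))
  then show ?thesis using mono_decomp[OF finite_coeff2 order.refl, of P] by argo
qed

text \<open>The map \<Phi> \<otimes> \<tau>, given through the basis \<open>bmonom k\<close>;
  \<open>lift_tens\<close> shows that it behaves as expected on all pure tensors.\<close>

definition lift ::
  "(complex \<Rightarrow> 'b::ab_group_add \<Rightarrow> 'b) \<Rightarrow> (complex poly poly \<Rightarrow> complex poly poly) \<Rightarrow> ('a::zero \<Rightarrow> 'b)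
    \<Rightarrow> (nat \<times> nat \<Rightarrow> 'a) \<Rightarrow> (nat \<times> nat \<Rightarrow> 'b)" where
  "lift sc \<Phi> \<tau> F = (\<Sum>k\<in>{k. F k \<noteq> 0}. tens sc (\<Phi> (bmonom k)) (\<tau> (F k)))"

lemma tens_act_eq_lift:
  "tens_act sc lam \<alpha> h D m F = lift sc (omega_act lam \<alpha> h m) (\<lambda>v. v) F + (\<lambda>k. D m (F k))"
  by (simp add: tens_act_def lift_def)

lemma tens_apply: "tens sc P v k = sc (coeff2 P k) v"
  by (simp add: tens_def split_beta)

lemma tens_carrier_0 [simp]: "0 \<in> tens_carrier"
  by (simp add: tens_carrier_def)

lemma tens_carrier_add:
  fixes F G :: "nat \<times> nat \<Rightarrow> 'a::monoid_add"
  assumes "F \<in> tens_carrier" "G \<in> tens_carrier"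
  shows "F + G \<in> tens_carrier"
proof -
  have "{k. (F + G) k \<noteq> 0} \<subseteq> {k. F k \<noteq> 0} \<union> {k. G k \<noteq> 0}" by auto
  with assms show ?thesis unfolding tens_carrier_def by (auto intro: finite_subset)
qed

lemma tens_carrier_sum:
  fixes F :: "'i \<Rightarrow> nat \<times> nat \<Rightarrow> 'a::comm_monoid_add"
  assumes "\<And>i. i \<in> A \<Longrightarrow> F i \<in> tens_carrier"
  shows "sum F A \<in> tens_carrier"
  using assms by (induction A rule: infinite_finite_induct) (auto intro: tens_carrier_add)

lemma tens_carrier_map:
  assumes "F \<in> tens_carrier" "T 0 = 0"
  shows "(\<lambda>k. T (F k)) \<in> tens_carrier"
proof -
  have "{k. T (F k) \<noteq> 0} \<subseteq> {k. F k \<noteq> 0}" using assms(2) by auto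
  with assms(1) show ?thesis unfolding tens_carrier_def by (auto intro: finite_subset)
qed

context complex_vs
begin

lemma tens_in_carrier: "tens sc P v \<in> tens_carrier"
proof -
  have "{k. tens sc P v k \<noteq> 0} \<subseteq> {k. coeff2 P k \<noteq> 0}" by (auto simp: tens_apply)
  then show ?thesis using finite_coeff2 by (auto simp: tens_carrier_def intro: finite_subset)
qed

lemma tens_scale_in_carrier: "F \<in> tens_carrier \<Longrightarrow> tens_scale sc a F \<in> tens_carrier"
  unfolding tens_scale_def by (rule tens_carrier_map[where T = "sc a"]) auto

lemma tens_add_left: "tens sc (P + Q) v = tens sc P v + tens sc Q v"
  and tens_add_right: "tens sc P (v + w) = tens sc P v + tens sc P w"
  and tens_smult: "tens sc (smult [:a:] P) v = tens_scale sc a (tens sc P v)"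
  and tens_scale_right: "tens sc P (sc a v) = tens_scale sc a (tens sc P v)"
  and tens_0_left [simp]: "tens sc 0 v = 0"
  and tens_0_right [simp]: "tens sc P 0 = 0"
  by (rule ext, simp add: tens_apply tens_scale_def scale_left_distrib scale_right_distrib ac_simps)+

lemma tens_sum_left: "tens sc (sum f A) v = (\<Sum>i\<in>A. tens sc (f i) v)"
  by (induction A rule: infinite_finite_induct) (auto simp: tens_add_left)

lemma tens_decomp:
  assumes "F \<in> tens_carrier"
  shows "F = (\<Sum>k\<in>{k. F k \<noteq> 0}. tens sc (bmonom k) (F k))"
proof
  fix k
  have "(\<Sum>l\<in>{l. F l \<noteq> 0}. tens sc (bmonom l) (F l)) k = (\<Sum>l\<in>{l. F l \<noteq> 0}. if k = l then F k else 0)"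
    unfolding sum_fun_apply tens_apply
    by (intro sum.cong refl) (auto simp: coeff2_mono simp del: coeff_monom)
  then show "F k = (\<Sum>l\<in>{l. F l \<noteq> 0}. tens sc (bmonom l) (F l)) k"
    using assms by (simp add: tens_carrier_def)
qed

lemma tens_induct [consumes 1, case_names tens add]:
  assumes "F \<in> tens_carrier" and tens: "\<And>P v. Q (tens sc P v)"
    and add: "\<And>F G. F \<in> tens_carrier \<Longrightarrow> G \<in> tens_carrier \<Longrightarrow> Q F \<Longrightarrow> Q G \<Longrightarrow> Q (F + G)"
  shows "Q F"
proof -
  have "sum (\<lambda>k. tens sc (bmonom k) (F k)) S \<in> tens_carrier
      \<and> Q (sum (\<lambda>k. tens sc (bmonom k) (F k)) S)" for S
    using tens[of 0 0]
    by (induction S rule: infinite_finite_induct) (auto intro!: add tens tens_carrier_add tens_in_carrier)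
  then have "Q (\<Sum>k\<in>{k. F k \<noteq> 0}. tens sc (bmonom k) (F k))" by blast
  then show ?thesis by (rule back_subst[of Q]) (rule tens_decomp[OF assms(1), symmetric])
qed

lemma tens_mono_pointwise: "tens sc (bmonom k) v l = (if l = k then v else 0)"
  unfolding tens_apply by (simp add: coeff2_mono del: coeff_monom)

end

lemma lift_superset:
  assumes "complex_vs sc" "finite S" "{k. F k \<noteq> 0} \<subseteq> S" "\<tau> 0 = 0"
  shows "lift sc \<Phi> \<tau> F = (\<Sum>k\<in>S. tens sc (\<Phi> (bmonom k)) (\<tau> (F k)))"
proof -
  interpret complex_vs sc by fact
  show ?thesis unfolding lift_def
    by (rule sum.mono_neutral_left) (use assms(2-) in auto)
qed

locale complex_linear = complex_vs sc1 + target: complex_vs sc2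
  for sc1 :: "complex \<Rightarrow> 'v::ab_group_add \<Rightarrow> 'v" and sc2 :: "complex \<Rightarrow> 'w::ab_group_add \<Rightarrow> 'w" +
  fixes \<tau> :: "'v \<Rightarrow> 'w"
  assumes \<tau>_add: "\<tau> (v + w) = \<tau> v + \<tau> w" and \<tau>_scale: "\<tau> (sc1 a v) = sc2 a (\<tau> v)"
begin

lemma \<tau>_0: "\<tau> 0 = 0"
  using \<tau>_scale[of 0 0] by simp

lemma lift_in_carrier: "lift sc2 \<Phi> \<tau> F \<in> tens_carrier"
  unfolding lift_def by (intro tens_carrier_sum target.tens_in_carrier)

lemma lift_add:
  assumes "F \<in> tens_carrier" "G \<in> tens_carrier"
  shows "lift sc2 \<Phi> \<tau> (F + G) = lift sc2 \<Phi> \<tau> F + lift sc2 \<Phi> \<tau> G"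
proof -
  define S where "S = {k. F k \<noteq> 0} \<union> {k. G k \<noteq> 0}"
  have "finite S" using assms by (simp add: S_def tens_carrier_def)
  then have *: "lift sc2 \<Phi> \<tau> H = (\<Sum>k\<in>S. tens sc2 (\<Phi> (bmonom k)) (\<tau> (H k)))" if "{k. H k \<noteq> 0} \<subseteq> S" for H
    using that by (intro lift_superset target.complex_vs_axioms) (auto simp: \<tau>_0)
  have "lift sc2 \<Phi> \<tau> (F + G) = (\<Sum>k\<in>S. tens sc2 (\<Phi> (bmonom k)) (\<tau> ((F + G) k)))"
    "lift sc2 \<Phi> \<tau> F = (\<Sum>k\<in>S. tens sc2 (\<Phi> (bmonom k)) (\<tau> (F k)))"
    "lift sc2 \<Phi> \<tau> G = (\<Sum>k\<in>S. tens sc2 (\<Phi> (bmonom k)) (\<tau> (G k)))"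
    by (rule *, force simp: S_def)+
  then show ?thesis by (simp add: \<tau>_add target.tens_add_right sum.distrib)
qed

lemma lift_tens:
  assumes "poly_linear \<Phi>"
  shows "lift sc2 \<Phi> \<tau> (tens sc1 P v) = tens sc2 (\<Phi> P) (\<tau> v)"
proof -
  define S where "S = {k. coeff2 P k \<noteq> 0}"
  have S: "finite S" unfolding S_def by (rule finite_coeff2)
  have "lift sc2 \<Phi> \<tau> (tens sc1 P v) = (\<Sum>k\<in>S. tens sc2 (\<Phi> (bmonom k)) (\<tau> (tens sc1 P v k)))"
    by (rule lift_superset[OF target.complex_vs_axioms S]) (auto simp: S_def tens_apply \<tau>_0)
  also have "\<dots> = (\<Sum>k\<in>S. tens sc2 (smult [:coeff2 P k:] (\<Phi> (bmonom k))) (\<tau> v))"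
    by (simp only: tens_apply \<tau>_scale target.tens_scale_right target.tens_smult)
  also have "\<dots> = tens sc2 (\<Phi> (\<Sum>k\<in>S. smult [:coeff2 P k:] (bmonom k))) (\<tau> v)"
    by (simp only: target.tens_sum_left poly_linear_sum[OF assms] poly_linear_smult[OF assms])
  also have "(\<Sum>k\<in>S. smult [:coeff2 P k:] (bmonom k)) = P"
    using mono_decomp[OF S, of P] by (simp add: S_def)
  finally show ?thesis .
qed

lemma lift_scale:
  assumes "F \<in> tens_carrier"
  shows "lift sc2 \<Phi> \<tau> (tens_scale sc1 a F) = tens_scale sc2 a (lift sc2 \<Phi> \<tau> F)"
proof -
  have fin: "finite {k. F k \<noteq> 0}" using assms by (simp add: tens_carrier_def)
  have "lift sc2 \<Phi> \<tau> (tens_scale sc1 a F)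
      = (\<Sum>k\<in>{k. F k \<noteq> 0}. tens sc2 (\<Phi> (bmonom k)) (\<tau> (tens_scale sc1 a F k)))"
    by (rule lift_superset[OF target.complex_vs_axioms fin]) (auto simp: tens_scale_def \<tau>_0)
  also have "\<dots> = tens_scale sc2 a (lift sc2 \<Phi> \<tau> F)"
    by (simp add: lift_def fun_eq_iff tens_scale_def sum_fun_apply target.scale_sum_right \<tau>_scale
        tens_apply mult.commute)
  finally show ?thesis .
qed

end

lemma lift_comp:
  assumes "complex_linear sc1 sc2 \<tau>" "complex_linear sc2 sc3 \<sigma>" "poly_linear \<Phi>" "poly_linear \<Psi>"
    and F: "F \<in> tens_carrier"
  shows "lift sc3 \<Psi> \<sigma> (lift sc2 \<Phi> \<tau> F) = lift sc3 (\<lambda>P. \<Psi> (\<Phi> P)) (\<lambda>v. \<sigma> (\<tau> v)) F"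
proof -
  interpret f: complex_linear sc1 sc2 \<tau> by fact
  interpret g: complex_linear sc2 sc3 \<sigma> by fact
  interpret gf: complex_linear sc1 sc3 "\<lambda>v. \<sigma> (\<tau> v)"
    by unfold_locales (simp_all add: f.\<tau>_add g.\<tau>_add f.\<tau>_scale g.\<tau>_scale)
  show ?thesis
    using F
  proof (induction F rule: f.tens_induct)
    case (tens P v)
    show ?case
      by (simp add: f.lift_tens g.lift_tens gf.lift_tens poly_linear_comp assms(3,4))
  next
    case (add F G)
    then show ?case by (simp only: f.lift_add g.lift_add gf.lift_add f.lift_in_carrier)
  qed
qed

lemma (in complex_vs) lift_id:
  assumes "F \<in> tens_carrier"
  shows "lift sc (\<lambda>P. P) (\<lambda>v. v) F = F"
  unfolding lift_def by (rule tens_decomp[OF assms, symmetric])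

lemma vir_iso_inverse:
  assumes "vir_iso sc1 M1 D1 C1 sc2 M2 D2 C2 f"
    and "\<And>x y. x \<in> M1 \<Longrightarrow> y \<in> M1 \<Longrightarrow> x + y \<in> M1" "\<And>a x. x \<in> M1 \<Longrightarrow> sc1 a x \<in> M1"
      "\<And>m x. x \<in> M1 \<Longrightarrow> D1 m x \<in> M1" "\<And>x. x \<in> M1 \<Longrightarrow> C1 x \<in> M1"
  shows "vir_iso sc2 M2 D2 C2 sc1 M1 D1 C1 (inv_into M1 f)"
proof -
  let ?g = "inv_into M1 f"
  have f: "bij_betw f M1 M2" using assms(1) by (simp add: vir_iso_def)
  have g: "?g y \<in> M1" "f (?g y) = y" if "y \<in> M2" for y
    using f that by (auto simp: bij_betw_def inv_into_into f_inv_into_f)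
  have eq: "?g y = x" if "x \<in> M1" "f x = y" for x y
    using f that by (auto simp: bij_betw_def)
  show ?thesis
    using assms(1) unfolding vir_iso_def
    by (auto intro!: bij_betw_inv_into[OF f] eq simp: g assms(2-))
qed

subsection \<open>The operators on C[t,s]\<close>

lemma Fop_linear_poly: "Fop \<alpha> [:\<eta>, \<xi>:] f = smult \<xi> f - pderiv f"
proof -
  have "[:\<eta>, \<xi>:] - [:poly [:\<eta>, \<xi>:] \<alpha>:] = [:\<xi>:] * [:- \<alpha>, 1:]" by simp
  then have "([:\<eta>, \<xi>:] - [:poly [:\<eta>, \<xi>:] \<alpha>:]) div [:- \<alpha>, 1:] = [:\<xi>:]"
    using nonzero_mult_div_cancel_right[of "[:- \<alpha>, 1:]" "[:\<xi>:]"] by (metis one_neq_zero pCons_eq_0_iff)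
  then show ?thesis by (simp add: Fop_def)
qed

lemma Fop_add: "Fop \<alpha> h (f + g) = Fop \<alpha> h f + Fop \<alpha> h g"
  and Fop_smult: "Fop \<alpha> h (smult a f) = smult a (Fop \<alpha> h f)"
  by (simp_all add: Fop_def algebra_simps pderiv_add pderiv_smult smult_diff_right)

lemma Gop_add: "Gop \<alpha> h (f + g) = Gop \<alpha> h f + Gop \<alpha> h g"
  and Gop_smult: "Gop \<alpha> h (smult a f) = smult a (Gop \<alpha> h f)"
  by (simp_all add: Gop_def Fop_add Fop_smult smult_add_right algebra_simps)

lemma Fop_0 [simp]: "Fop \<alpha> h 0 = 0" and Gop_0 [simp]: "Gop \<alpha> h 0 = 0"
  by (simp_all add: Fop_def Gop_def)

section \<open>The action of d_m as a polynomial in m\<close>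

lemma smult_sum_right: "smult c (sum f A) = (\<Sum>i\<in>A. smult c (f i))"
  by (induction A rule: infinite_finite_induct) (simp_all add: smult_add_right)

text \<open>The polynomial in an extra variable \<open>m\<close> such that \<open>d_m P\<close> is \<open>\<lambda>^m\<close> times its value at \<open>m\<close>.\<close>
definition symbol_term :: "complex \<Rightarrow> complex poly \<Rightarrow> nat \<Rightarrow> complex poly \<Rightarrow> complex poly poly poly" where
  "symbol_term \<alpha> h i f = [:[:0, 1:], -1:] ^ i *
     [:[:0, f:], [:Gop \<alpha> h f:], [:smult (- \<alpha>) (Fop \<alpha> h f):]:]"

text \<open>The variables are nested with m outermost, then s, then t; the factor
  \<open>[:[:0, 1:], -1:]\<close> in \<open>symbol_term\<close> is s - m.\<close>

definition symbol :: "complex \<Rightarrow> complex poly \<Rightarrow> complex poly poly \<Rightarrow> complex poly poly poly" where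
  "symbol \<alpha> h P = (\<Sum>i\<le>degree P. symbol_term \<alpha> h i (coeff P i))"

text \<open>The operator A_j on \<Omega> alone; tensoring it with the identity of V gives A_j on the
  tensor product.\<close>

definition symbol_coeff :: "complex \<Rightarrow> complex poly \<Rightarrow> nat \<Rightarrow> complex poly poly \<Rightarrow> complex poly poly" where
  "symbol_coeff \<alpha> h j P = coeff (symbol \<alpha> h P) j"

lemma symbol_term_0 [simp]: "symbol_term \<alpha> h i 0 = 0"
  by (simp add: symbol_term_def)

lemma symbol_term_add: "symbol_term \<alpha> h i (f + g) = symbol_term \<alpha> h i f + symbol_term \<alpha> h i g"
proof -
  have "[:[:0, f + g:], [:Gop \<alpha> h (f + g):], [:smult (- \<alpha>) (Fop \<alpha> h (f + g)):]:]
      = [:[:0, f:], [:Gop \<alpha> h f:], [:smult (- \<alpha>) (Fop \<alpha> h f):]:]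
        + [:[:0, g:], [:Gop \<alpha> h g:], [:smult (- \<alpha>) (Fop \<alpha> h g):]:]"
    by (simp add: Fop_add Gop_add smult_add_right)
  then show ?thesis unfolding symbol_term_def by (simp only: distrib_left)
qed

lemma symbol_term_smult: "symbol_term \<alpha> h i (smult a f) = smult [:[:a:]:] (symbol_term \<alpha> h i f)"
proof -
  have "[:[:0, smult a f:], [:Gop \<alpha> h (smult a f):], [:smult (- \<alpha>) (Fop \<alpha> h (smult a f)):]:]
      = smult [:[:a:]:] [:[:0, f:], [:Gop \<alpha> h f:], [:smult (- \<alpha>) (Fop \<alpha> h f):]:]"
    by (simp add: Fop_smult Gop_smult mult.commute)
  then show ?thesis unfolding symbol_term_def by (simp only: mult_smult_right)
qed

lemma symbol_eq:
  assumes "degree P \<le> n"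
  shows "symbol \<alpha> h P = (\<Sum>i\<le>n. symbol_term \<alpha> h i (coeff P i))"
  unfolding symbol_def
  by (rule sum.mono_neutral_left) (use assms in \<open>auto simp: coeff_eq_0\<close>)

lemma symbol_add: "symbol \<alpha> h (P + Q) = symbol \<alpha> h P + symbol \<alpha> h Q"
proof -
  define n where "n = max (degree P) (degree Q)"
  have "degree (P + Q) \<le> n" "degree P \<le> n" "degree Q \<le> n"
    by (auto simp: n_def degree_add_le_max)
  then show ?thesis by (simp add: symbol_eq[of _ n] symbol_term_add sum.distrib)
qed

lemma symbol_smult: "symbol \<alpha> h (smult [:a:] P) = smult [:[:a:]:] (symbol \<alpha> h P)"
  using symbol_eq[OF degree_smult_le[of "[:a:]" P], of \<alpha> h]
  by (simp add: symbol_def symbol_term_smult smult_sum_right)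

lemma symbol_monom: "symbol \<alpha> h (monom f i) = symbol_term \<alpha> h i f"
proof -
  have "symbol \<alpha> h (monom f i) = (\<Sum>j\<le>i. symbol_term \<alpha> h j (coeff (monom f i) j))"
    by (rule symbol_eq) (simp add: degree_monom_le)
  also have "\<dots> = (\<Sum>j\<le>i. if j = i then symbol_term \<alpha> h i f else 0)"
    by (intro sum.cong) auto
  finally show ?thesis by simp
qed

lemma poly_linear_symbol_coeff: "poly_linear (symbol_coeff \<alpha> h j)"
  by (intro poly_linearI) (simp_all add: symbol_coeff_def symbol_add symbol_smult)

lemma omega_act_eq_poly_symbol:
  "omega_act lam \<alpha> h m P = smult [:lam powi m:] (poly (symbol \<alpha> h P) [:[:of_int m:]:])"
proof -
  have "poly (symbol_term \<alpha> h i f) [:[:of_int m:]:] = [:- [:of_int m:], 1:] ^ i *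
      ([:0, 1:] * [:f:] + [:smult (of_int m) (Gop \<alpha> h f) - smult ((of_int m)\<^sup>2 * \<alpha>) (Fop \<alpha> h f):])" for i f
  proof -
    have "poly [:[:0, f:], [:Gop \<alpha> h f:], [:smult (- \<alpha>) (Fop \<alpha> h f):]:] [:[:of_int m:]:]
        = [:0, 1:] * [:f:] + [:smult (of_int m) (Gop \<alpha> h f) - smult ((of_int m)\<^sup>2 * \<alpha>) (Fop \<alpha> h f):]"
      by (simp add: power2_eq_square smult_diff_right mult_ac)
    moreover have "poly [:[:0, 1:], -1:] [:[:of_int m:]:] = [:- [:of_int m:], 1 :: complex poly:]" by simp
    ultimately show ?thesis unfolding symbol_term_def by (simp only: poly_mult poly_power)
  qed
  then show ?thesis
    unfolding omega_act_def symbol_def poly_sum smult_sum_right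
    by (intro sum.cong refl) (simp only: mult.assoc, simp)
qed

lemma poly_linear_omega_act: "poly_linear (omega_act lam \<alpha> h m)"
  by (intro poly_linearI)
    (simp_all add: omega_act_eq_poly_symbol symbol_add symbol_smult smult_add_right mult.commute)

lemma degree_symbol_term: "degree (symbol_term \<alpha> h i f) \<le> i + 2"
proof -
  have "degree ([:[:0, 1:], -1:] ^ i :: complex poly poly poly) \<le> 1 * i"
    by (rule order.trans[OF degree_power_le]) simp
  moreover have "degree [:[:0, f:], [:Gop \<alpha> h f:], [:smult (- \<alpha>) (Fop \<alpha> h f):]:] \<le> 2"
    by (simp add: degree_pCons_eq_if)
  ultimately show ?thesis
    unfolding symbol_term_def by (intro order.trans[OF degree_mult_le]) simp
qed

lemma degree_symbol: "degree (symbol \<alpha> h P) \<le> degree P + 2"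
  unfolding symbol_def by (intro degree_sum_le) (auto intro: order.trans[OF degree_symbol_term])

lemma omega_act_eq_sum:
  assumes "degree P + 2 \<le> n"
  shows "omega_act lam \<alpha> h m P
    = smult [:lam powi m:] (\<Sum>j\<le>n. smult [:of_int m ^ j:] (symbol_coeff \<alpha> h j P))"
proof -
  have "poly (symbol \<alpha> h P) [:[:of_int m:]:] = (\<Sum>j\<le>n. coeff (symbol \<alpha> h P) j * [:[:of_int m:]:] ^ j)"
    unfolding poly_altdef
    by (rule sum.mono_neutral_left)
      (use degree_symbol[of \<alpha> h P] assms in \<open>auto simp: coeff_eq_0\<close>)
  then show ?thesis
    by (simp add: omega_act_eq_poly_symbol symbol_coeff_def poly_const_pow mult.commute)
qed

lemma symbol_coeff_monom_eq_0: "j > i + 2 \<Longrightarrow> symbol_coeff \<alpha> h j (monom f i) = 0"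
  unfolding symbol_coeff_def symbol_monom
  using degree_symbol_term[of \<alpha> h i f] by (intro coeff_eq_0) simp

text \<open>The highest power of m in (s - m)^i (s f + m G f - m^2 \<alpha> F f) comes from (-m)^i
  and the quadratic term. This lets the operators detect the s-degree.\<close>

lemma symbol_coeff_monom_top:
  "symbol_coeff \<alpha> h (i + 2) (monom f i) = [:smult (- ((-1) ^ i * \<alpha>)) (Fop \<alpha> h f):]"
proof -
  define A :: "complex poly poly poly" where "A = [:[:0, 1:], -1:]"
  have A: "degree (A ^ i) = i" "coeff (A ^ i) i = (-1) ^ i"
  proof -
    show d: "degree (A ^ i) = i" by (simp add: degree_power_eq A_def)
    show "coeff (A ^ i) i = (-1) ^ i" using lead_coeff_power[of A i] d by (simp add: A_def)
  qed
  have coeff_top: "coeff (A ^ i * [:a, b, c:]) (i + 2) = (-1) ^ i * c" for a b c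
  proof -
    have "A ^ i * [:a, b, c:] = smult a (A ^ i) + pCons 0 (smult b (A ^ i) + pCons 0 (smult c (A ^ i)))"
      by (simp add: mult.commute)
    then show ?thesis using A by (simp add: coeff_eq_0 mult.commute)
  qed
  show ?thesis
    unfolding symbol_coeff_def symbol_monom symbol_term_def A_def[symmetric] coeff_top
    by (cases "even i") simp_all
qed

lemma symbol_coeff_0: "symbol_coeff \<alpha> h 0 P = pCons 0 P"
proof (rule poly_linear_eqI[OF poly_linear_symbol_coeff])
  show "poly_linear (pCons 0)" by (rule poly_linearI) simp_all
  show "symbol_coeff \<alpha> h 0 (bmonom k) = pCons 0 (bmonom k)" for k
    by (simp add: symbol_coeff_def symbol_monom symbol_term_def coeff_mult_0 coeff_0_power
        flip: monom_altdef)
qed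

lemma symbol_coeff_1_const: "symbol_coeff \<alpha> h 1 [:f:] = [:Gop \<alpha> h f:]"
  and symbol_coeff_2_const: "symbol_coeff \<alpha> h 2 [:f:] = [:smult (- \<alpha>) (Fop \<alpha> h f):]"
  using symbol_monom[of \<alpha> h f 0]
  by (simp_all add: symbol_coeff_def symbol_term_def monom_0 numeral_2_eq_2)

subsection \<open>Independence of exponential polynomials\<close>

text \<open>Passing to differences in m lowers the degree of q, whereas p becomes \<open>p'\<close>,
  whose coefficient in degree \<open>degree p\<close> is \<mu> - 1 times the leading one of p.
  Induction on the degree of q gives \<open>p' = 0\<close>, hence p = 0.\<close>

lemma exp_poly_independent_scalar:
  fixes \<mu> :: complex
  assumes "\<mu> \<noteq> 0" "\<mu> \<noteq> 1"
  shows "(\<And>m. m \<ge> N \<Longrightarrow> \<mu> ^ m * poly p (of_nat m) = poly q (of_nat m)) \<Longrightarrow> p = 0 \<and> q = 0"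
proof (induction "degree q" arbitrary: p q rule: less_induct)
  case less
  have zero: "r = 0" if "\<And>m. m \<ge> N \<Longrightarrow> poly r (of_nat m) = 0" for r :: "complex poly"
  proof (rule ccontr)
    assume "r \<noteq> 0"
    then have "finite {x. poly r x = 0}" by (rule poly_roots_finite)
    moreover have "of_nat ` {N..} \<subseteq> {x. poly r x = 0}" using that by auto
    ultimately have "finite ((of_nat :: nat \<Rightarrow> complex) ` {N..})" by (rule finite_subset[rotated])
    then show False by (simp add: finite_image_iff infinite_Ici inj_on_def)
  qed
  show ?case
  proof (cases "q = 0")
    case True
    with less.prems assms(1) show ?thesis by (auto intro!: zero)
  next
    case q: False
    define q' where "q' = pcompose q [:1, 1:] - q"
    define p' where "p' = smult \<mu> (pcompose p [:1, 1:]) - p"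
    have rel: "\<mu> ^ m * poly p' (of_nat m) = poly q' (of_nat m)" if "m \<ge> N" for m
      using less.prems[of m] less.prems[of "Suc m"] that
      by (simp add: p'_def q'_def poly_pcompose algebra_simps)
    have "p' = 0"
    proof (cases "degree q = 0")
      case True
      then obtain c where "q = [:c:]" by (rule degree_eq_zeroE)
      then have "q' = 0" by (simp add: q'_def)
      then show ?thesis using rel assms(1) by (auto intro!: zero)
    next
      case False
      have deg: "degree (pcompose q [:1, 1:]) = degree q" by (simp add: degree_pcompose)
      then have "coeff (pcompose q [:1, 1:]) (degree q) = lead_coeff q"
        using lead_coeff_comp[of "[:1, 1:]" q] by simp
      then have "coeff q' (degree q) = 0" by (simp add: q'_def)
      moreover have "degree q' \<le> degree q" unfolding q'_def using deg by (intro degree_diff_le) auto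
      ultimately have "degree q' < degree q"
        using False by (metis degree_0 le_neq_implies_less leading_coeff_0_iff neq0_conv)
      then show ?thesis using less.hyps[of q' p'] rel by blast
    qed
    have "coeff p' (degree p) = (\<mu> - 1) * lead_coeff p"
      using lead_coeff_comp[of "[:1, 1:]" p]
      by (simp add: p'_def degree_pcompose algebra_simps)
    then have "p = 0" using \<open>p' = 0\<close> assms(2) by simp
    then have "q = 0" using less.prems by (auto intro!: zero)
    with \<open>p = 0\<close> show ?thesis by simp
  qed
qed

context complex_vs
begin

lemma exp_poly_independent:
  assumes lam: "lam1 \<noteq> 0" "lam2 \<noteq> 0"
    and eq: "\<And>m. m \<ge> N \<Longrightarrow> sc (lam1 ^ m) (\<Sum>j\<le>J. sc (of_nat m ^ j) (x j))
      = sc (lam2 ^ m) (\<Sum>j\<le>J. sc (of_nat m ^ j) (y j))"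
    and "j \<le> J"
  shows "if lam1 = lam2 then x j = y j else x j = 0 \<and> y j = 0"
proof -
  have *: "if lam1 = lam2 then l (x j) = l (y j) else l (x j) = 0 \<and> l (y j) = 0"
    if l: "\<And>x z. l (x + z) = l x + l z" "\<And>a x. l (sc a x) = a * l x" for l
  proof -
    have l0: "l 0 = 0" using l(2)[of 0 0] by simp
    then have l_sum: "l (sum f A) = (\<Sum>i\<in>A. l (f i))" for f and A :: "nat set"
      by (induction A rule: infinite_finite_induct) (simp_all add: l)
    define p where "p = (\<Sum>j\<le>J. monom (l (x j)) j)"
    define q where "q = (\<Sum>j\<le>J. monom (l (y j)) j)"
    have cp: "coeff p j = l (x j)" "coeff q j = l (y j)"
      using \<open>j \<le> J\<close> by (simp_all add: p_def q_def coeff_sum)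
    have rel: "lam1 ^ m * poly p (of_nat m) = lam2 ^ m * poly q (of_nat m)" if "m \<ge> N" for m
      using arg_cong[OF eq[OF that], of l]
      by (simp add: l l_sum p_def q_def poly_sum poly_monom mult.commute)
    show ?thesis
    proof (cases "lam1 = lam2")
      case True
      then have "poly (p - q) (of_nat m) = 0" if "m \<ge> N" for m
        using rel[OF that] lam by simp
      \<comment> \<open>With p replaced by 0 any ratio besides 0 and 1 serves: the scalar lemma says
        that a polynomial vanishing at all large naturals is 0.\<close>
      then have "2 ^ m * poly 0 (of_nat m) = poly (p - q) (of_nat m)" if "m \<ge> N" for m
        using that by simp
      then have "p - q = 0" using exp_poly_independent_scalar[of 2 N 0 "p - q"] by simp
      then show ?thesis using cp True by simp
    next
      case False
      then have "p = 0 \<and> q = 0"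
        using rel lam
        by (intro exp_poly_independent_scalar[of "lam1 / lam2" N p q])
          (auto simp: power_divide field_simps)
      then show ?thesis using cp False by simp
    qed
  qed
  have zero: "x = 0" if "\<And>l. (\<And>x z. l (x + z) = l x + l z) \<Longrightarrow> (\<And>a x. l (sc a x) = a * l x) \<Longrightarrow> l x = 0" for x
    using ex_separating_functional that by metis
  show ?thesis
  proof (cases "lam1 = lam2")
    case True
    have "x j - y j = 0"
    proof (rule zero)
      fix l assume l: "\<And>x z. l (x + z) = l x + l z" "\<And>a x. l (sc a x) = a * l x"
      show "l (x j - y j) = 0"
        using *[of l] l(1)[of "x j - y j" "y j"] l True by simp
    qed
    with True show ?thesis by simp
  next
    case False
    then show ?thesis using * zero[of "x j"] zero[of "y j"] by metis
  qed
qed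

end

subsection \<open>The sequences \<open>b\<close> and \<open>g\<close>\<close>

lemma power_X_eq_monom: "[:0, 1:] ^ n = (monom 1 n :: 'a::comm_semiring_1 poly)"
  using monom_altdef[of "1 :: 'a" n] by simp

lemma coeff_gpoly_X: "coeff (gpoly c n [:0, 1:]) j = of_nat (n choose j) * bseq c (n - j)"
proof -
  have "coeff (gpoly c n [:0, 1:]) j = (\<Sum>i\<le>n. if i = j then of_nat (n choose j) * bseq c (n - j) else 0)"
    unfolding gpoly_def coeff_sum by (intro sum.cong refl) (simp add: power_X_eq_monom)
  also have "\<dots> = of_nat (n choose j) * bseq c (n - j)"
    by (simp add: sum.delta binomial_eq_0)
  finally show ?thesis .
qed

text \<open>Identities for g_n are proved by comparing coefficients in a variable and carried to h
  by this substitution.\<close>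

lemma gpoly_pcompose: "pcompose (gpoly c n [:0, 1:]) h = gpoly c n h"
proof -
  have "pcompose ([:0, 1:] ^ j) h = h ^ j" for j
    by (induction j) (simp_all add: pcompose_mult pcompose_pCons one_pCons)
  then show ?thesis by (simp add: gpoly_def pcompose_sum pcompose_smult)
qed

lemma gpoly_0 [simp]: "gpoly c 0 h = 1"
  by (simp add: gpoly_def)

lemma gpoly_1: "gpoly c (Suc 0) h = h"
  by (simp add: gpoly_def)

lemma gpoly_rec:
  "gpoly c (Suc (Suc n)) h = h * gpoly c (Suc n) h
    + smult (of_nat (Suc n)) (gpoly c (Suc n) h - h * gpoly c n h + smult c (gpoly c n h))"
proof -
  let ?g = "\<lambda>n. gpoly c n [:0, 1:]"
  have "?g (Suc (Suc n)) = pCons 0 (?g (Suc n))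
      + smult (of_nat (Suc n)) (?g (Suc n) - pCons 0 (?g n) + smult c (?g n))"
  proof (rule poly_eqI)
    fix j
    show "coeff (?g (Suc (Suc n))) j = coeff (pCons 0 (?g (Suc n))
      + smult (of_nat (Suc n)) (?g (Suc n) - pCons 0 (?g n) + smult c (?g n))) j"
    proof (cases j)
      case 0
      then show ?thesis by (simp add: coeff_gpoly_X algebra_simps)
    next
      case j: (Suc i)
      \<comment> \<open>What remains of the coefficient of x^(i+1) after Pascal's rule. For i < n it
        is the recurrence of \<open>bseq\<close> with absorption for the binomials; for i = n both
        sides vanish, the left one because b_1 = 0.\<close>
      have "of_nat (Suc n choose Suc i) * bseq c (Suc n - i)
          = of_nat (Suc n) * of_nat (n choose Suc i) * (bseq c (n - i) + c * bseq c (n - Suc i))"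
      proof (cases "i < n")
        case True
        then obtain k where k: "n = i + Suc k" using less_imp_Suc_add by fastforce
        have "Suc k * (Suc n choose Suc i) = Suc n * (n choose Suc i)"
          using binomial_absorb_comp[of "Suc n" "Suc i"] k by simp
        then have "of_nat (Suc k) * of_nat (Suc n choose Suc i)
            = (of_nat (Suc n) * of_nat (n choose Suc i) :: complex)"
          by (metis of_nat_mult)
        moreover have "Suc n - i = Suc (Suc k)" "n - i = Suc k" "n - Suc i = k" using k by auto
        ultimately show ?thesis by (simp add: algebra_simps del: of_nat_Suc binomial_Suc_Suc)
      next
        case False
        then show ?thesis by (cases "i = n") (auto simp: binomial_eq_0)
      qed
      then show ?thesis by (simp add: j coeff_gpoly_X algebra_simps)
    qed
  qed
  from arg_cong[OF this, of "\<lambda>p. pcompose p h"] show ?thesis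
    by (simp add: gpoly_pcompose pcompose_add pcompose_diff pcompose_smult pcompose_pCons)
qed

lemma pderiv_gpoly: "pderiv (gpoly c (Suc n) h) = smult (of_nat (Suc n)) (gpoly c n h) * pderiv h"
proof -
  let ?g = "\<lambda>n. gpoly c n [:0, 1:]"
  have "pderiv (?g (Suc n)) = smult (of_nat (Suc n)) (?g n)"
  proof (rule poly_eqI)
    fix j
    have "of_nat (Suc j) * of_nat (Suc n choose Suc j) = (of_nat (Suc n) * of_nat (n choose j) :: complex)"
      using Suc_times_binomial_eq[of n j] by (metis of_nat_mult mult.commute)
    then show "coeff (pderiv (?g (Suc n))) j = coeff (smult (of_nat (Suc n)) (?g n)) j"
      by (simp add: coeff_pderiv coeff_gpoly_X mult.assoc[symmetric] del: of_nat_Suc binomial_Suc_Suc)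
  qed
  from arg_cong[OF this, of "\<lambda>p. pcompose p h * pderiv h"] show ?thesis
    by (simp add: gpoly_pcompose pcompose_smult flip: pderiv_pcompose del: of_nat_Suc)
qed

text \<open>With \<open>f'\<close> the derivative with respect to \<open>h\<close>, this reads
  \<open>G f = h f + \<beta> f - (h - \<eta>) f'\<close>, where \<open>\<beta> = \<alpha> \<xi>\<close>.\<close>
lemma Gop_pderiv:
  assumes "pderiv f = smult \<xi> f'"
  shows "Gop \<alpha> [:\<eta>, \<xi>:] f = [:\<eta>, \<xi>:] * f + smult (\<alpha> * \<xi>) f - [:\<eta>, \<xi>:] * f' + smult \<eta> f'"
proof -
  have "pCons 0 (smult \<xi> f') = [:\<eta>, \<xi>:] * f' - smult \<eta> f'" by simp
  then show ?thesis
    using assms by (simp add: Gop_def Fop_linear_poly smult_add_left algebra_simps)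
qed

lemma Gop_1: "Gop \<alpha> [:\<eta>, \<xi>:] 1 = [:\<eta>, \<xi>:] + smult (\<alpha> * \<xi>) 1"
  using Gop_pderiv[of 1 \<xi> 0] by (simp add: one_pCons)

text \<open>Solved for the highest power, this generates all powers of h from 1 by G, so a linear
  map intertwining G is determined by its value at 1.\<close>

lemma Gop_power_Suc:
  fixes \<xi> \<eta> :: complex
  defines "h \<equiv> [:\<eta>, \<xi>:]"
  shows "Gop \<alpha> h (h ^ Suc n) = h ^ Suc (Suc n) + smult (\<alpha> * \<xi> - of_nat (Suc n)) (h ^ Suc n)
    + smult (\<eta> * of_nat (Suc n)) (h ^ n)"
proof -
  have "pderiv (h ^ Suc n) = smult \<xi> (smult (of_nat (Suc n)) (h ^ n))"
    unfolding h_def pderiv_power_Suc by (simp add: pderiv_pCons mult.commute del: of_nat_Suc)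
  from Gop_pderiv[OF this[unfolded h_def]] show ?thesis
    by (simp add: h_def smult_diff_left mult.commute del: mult_pCons_left mult_pCons_right of_nat_Suc)
qed

text \<open>The relation of \<open>Gop_power_Suc\<close> with \<eta>1 although the operator contains
  \<eta>2: the constant \<eta>2 - \<eta>1 in \<open>gpoly_rec\<close> makes up the
  difference.\<close>

lemma Gop_gpoly_Suc:
  fixes \<xi>2 \<eta>2 :: complex
  defines "h2 \<equiv> [:\<eta>2, \<xi>2:]"
  shows "Gop \<alpha> h2 (gpoly (\<eta>2 - \<eta>1) (Suc n) h2) = gpoly (\<eta>2 - \<eta>1) (Suc (Suc n)) h2
    + smult (\<alpha> * \<xi>2 - of_nat (Suc n)) (gpoly (\<eta>2 - \<eta>1) (Suc n) h2)
    + smult (\<eta>1 * of_nat (Suc n)) (gpoly (\<eta>2 - \<eta>1) n h2)"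
proof -
  define g where "g n = gpoly (\<eta>2 - \<eta>1) n h2" for n
  have "pderiv (g (Suc n)) = smult \<xi>2 (smult (of_nat (Suc n)) (g n))"
    by (simp add: g_def h2_def pderiv_gpoly pderiv_pCons mult.commute)
  from Gop_pderiv[OF this] have Gop: "Gop \<alpha> h2 (g (Suc n)) = h2 * g (Suc n) + smult (\<alpha> * \<xi>2) (g (Suc n))
      - h2 * smult (of_nat (Suc n)) (g n) + smult \<eta>2 (smult (of_nat (Suc n)) (g n))"
    by (simp add: h2_def)
  have rec: "g (Suc (Suc n)) = h2 * g (Suc n)
      + smult (of_nat (Suc n)) (g (Suc n) - h2 * g n + smult (\<eta>2 - \<eta>1) (g n))"
    unfolding g_def by (rule gpoly_rec)
  have "Gop \<alpha> h2 (g (Suc n)) = g (Suc (Suc n))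
    + smult (\<alpha> * \<xi>2 - of_nat (Suc n)) (g (Suc n)) + smult (\<eta>1 * of_nat (Suc n)) (g n)"
    unfolding Gop rec
    by (simp add: smult_diff_left smult_diff_right smult_add_right algebra_simps del: of_nat_Suc)
  then show ?thesis by (simp add: g_def)
qed

subsection \<open>Tensor product modules\<close>

text \<open>Irreducibility and local finiteness enter as \<open>nontrivial\<close> and
  \<open>eventually_annihilated\<close>, which \<open>omega_tensor_irreducible\<close>
  supplies.\<close>

locale omega_tensor = complex_vs sc for sc :: "complex \<Rightarrow> 'v::ab_group_add \<Rightarrow> 'v" +
  fixes D :: "int \<Rightarrow> 'v \<Rightarrow> 'v" and C :: "'v \<Rightarrow> 'v" and lam \<alpha> \<xi> \<eta> :: complex
  assumes D_add: "D m (v + w) = D m v + D m w" and D_scale: "D m (sc a v) = sc a (D m v)"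
    and C_add: "C (v + w) = C v + C w" and C_scale: "C (sc a v) = sc a (C v)"
    and nonzero: "lam \<noteq> 0" "\<alpha> \<noteq> 0" "\<xi> \<noteq> 0" and nontrivial: "\<exists>v::'v. v \<noteq> 0"
    and eventually_annihilated: "\<exists>N. \<forall>n\<ge>N. D n v = 0"
begin

abbreviation "act \<equiv> tens_act sc lam \<alpha> [:\<eta>, \<xi>:] D"
abbreviation "scl \<equiv> tens_scale sc"
abbreviation "A j \<equiv> lift sc (symbol_coeff \<alpha> [:\<eta>, \<xi>:] j) (\<lambda>v. v)"

sublocale id: complex_linear sc sc "\<lambda>v. v"
  by unfold_locales auto

lemma D_0 [simp]: "D m 0 = 0" and C_0 [simp]: "C 0 = 0"
  using D_scale[of m 0 0] C_scale[of 0 0] by simp_all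

lemma scl_add: "scl a (F + G) = scl a F + scl a G"
  by (simp add: tens_scale_def fun_eq_iff scale_right_distrib)

lemma scl_in_carrier: "F \<in> tens_carrier \<Longrightarrow> scl a F \<in> tens_carrier"
  by (rule tens_scale_in_carrier)

lemma act_in_carrier: "F \<in> tens_carrier \<Longrightarrow> act m F \<in> tens_carrier"
  unfolding tens_act_eq_lift
  by (intro tens_carrier_add id.lift_in_carrier tens_carrier_map[where T = "D m"]) auto

lemma C_in_carrier: "F \<in> tens_carrier \<Longrightarrow> tens_C C F \<in> tens_carrier"
  unfolding tens_C_def by (rule tens_carrier_map[where T = C]) auto

lemma act_add:
  assumes "F \<in> tens_carrier" "G \<in> tens_carrier"
  shows "act m (F + G) = act m F + act m G"
  unfolding tens_act_eq_lift id.lift_add[OF assms] by (simp add: fun_eq_iff D_add)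

lemma tens_D: "(\<lambda>k. D m (tens sc P v k)) = tens sc P (D m v)"
  by (simp add: fun_eq_iff tens_apply D_scale)

lemma act_tens: "act m (tens sc P v) = tens sc (omega_act lam \<alpha> [:\<eta>, \<xi>:] m P) v + tens sc P (D m v)"
  by (simp add: tens_act_eq_lift id.lift_tens poly_linear_omega_act tens_D)

lemma C_tens: "tens_C C (tens sc P v) = tens sc P (C v)"
  by (simp add: tens_C_def fun_eq_iff tens_apply C_scale)

lemma A_tens: "A j (tens sc P v) = tens sc (symbol_coeff \<alpha> [:\<eta>, \<xi>:] j P) v"
  by (rule id.lift_tens[OF poly_linear_symbol_coeff])

lemma A_add: "F \<in> tens_carrier \<Longrightarrow> G \<in> tens_carrier \<Longrightarrow> A j (F + G) = A j F + A j G"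
  by (rule id.lift_add)

lemma tens_omega_act:
  assumes "degree P + 2 \<le> n"
  shows "tens sc (omega_act lam \<alpha> [:\<eta>, \<xi>:] m P) v
    = scl (lam powi m) (\<Sum>j\<le>n. scl (of_int m ^ j) (A j (tens sc P v)))"
  unfolding omega_act_eq_sum[OF assms] A_tens by (simp only: tens_smult tens_sum_left)

lemma act_expansion:
  assumes "F \<in> tens_carrier"
  shows "\<exists>J0 N. \<forall>J\<ge>J0. \<forall>m\<ge>N. act (int m) F = scl (lam ^ m) (\<Sum>j\<le>J. scl (of_nat m ^ j) (A j F))"
  using assms
proof (induction F rule: tens_induct)
  case (tens P v)
  obtain N where N: "\<And>n. n \<ge> N \<Longrightarrow> D n v = 0" using eventually_annihilated by blast
  have "act (int m) (tens sc P v) = scl (lam ^ m) (\<Sum>j\<le>J. scl (of_nat m ^ j) (A j (tens sc P v)))"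
    if "J \<ge> degree P + 2" "m \<ge> nat N" for J m
    using N[of "int m"] tens_omega_act[OF that(1), of "int m" v] that(2) by (simp add: act_tens)
  then show ?case by blast
next
  case (add F G)
  then obtain J1 N1 J2 N2 where
    1: "\<And>J m. J \<ge> J1 \<Longrightarrow> m \<ge> N1 \<Longrightarrow> act (int m) F = scl (lam ^ m) (\<Sum>j\<le>J. scl (of_nat m ^ j) (A j F))" and
    2: "\<And>J m. J \<ge> J2 \<Longrightarrow> m \<ge> N2 \<Longrightarrow> act (int m) G = scl (lam ^ m) (\<Sum>j\<le>J. scl (of_nat m ^ j) (A j G))"
    by blast
  have "act (int m) (F + G) = scl (lam ^ m) (\<Sum>j\<le>J. scl (of_nat m ^ j) (A j (F + G)))"
    if "J \<ge> max J1 J2" "m \<ge> max N1 N2" for J m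
    using 1[of J m] 2[of J m] that add.hyps by (simp only: act_add A_add scl_add sum.distrib)
  then show ?case by blast
qed

section \<open>Leading terms of the operators A_j\<close>

lemma A_apply:
  assumes "F \<in> tens_carrier"
  shows "A j F k = (\<Sum>l\<in>{l. F l \<noteq> 0}. sc (coeff2 (symbol_coeff \<alpha> [:\<eta>, \<xi>:] j (bmonom l)) k) (F l))"
  by (simp add: lift_def sum_fun_apply tens_apply)

lemma coeff_Fop_monom:
  "coeff (Fop \<alpha> [:\<eta>, \<xi>:] (monom 1 b)) a
    = (if b = a then \<xi> else 0) - (if b = Suc a then of_nat (Suc a) else 0)"
  by (auto simp: Fop_linear_poly coeff_pderiv)

text \<open>Monomials of s-degree below i are killed by A_(i+2). In s-degree i, t^b contributes
  multiples of t^b and t^(b-1), so t^a arises from b = a alone when no b > a occurs.\<close>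

lemma A_top_apply:
  assumes F: "F \<in> tens_carrier" "\<And>a' i'. i < i' \<Longrightarrow> F (a', i') = 0"
    and a: "\<And>a'. a < a' \<Longrightarrow> F (a', i) = 0"
  shows "A (i + 2) F (a, 0) = sc (- ((-1) ^ i * \<alpha> * \<xi>)) (F (a, i))"
proof -
  have "A (i + 2) F (a, 0)
      = (\<Sum>l\<in>{l. F l \<noteq> 0}. if l = (a, i) then sc (- ((-1) ^ i * \<alpha> * \<xi>)) (F (a, i)) else 0)"
    unfolding A_apply[OF F(1)]
  proof (intro sum.cong refl)
    fix l assume "l \<in> {l. F l \<noteq> 0}"
    obtain b i' where l: "l = (b, i')" by fastforce
    have "\<not> i < i'" "i' = i \<Longrightarrow> \<not> a < b"
      using \<open>l \<in> {l. F l \<noteq> 0}\<close> F(2)[of i' b] a[of b] by (auto simp: l)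
    then have "i' < i \<or> i' = i \<and> b \<le> a" by linarith
    then show "sc (coeff2 (symbol_coeff \<alpha> [:\<eta>, \<xi>:] (i + 2) (bmonom l)) (a, 0)) (F l)
        = (if l = (a, i) then sc (- ((-1) ^ i * \<alpha> * \<xi>)) (F (a, i)) else 0)"
    proof
      assume "i' < i"
      then show ?thesis by (simp add: l symbol_coeff_monom_eq_0)
    next
      assume "i' = i \<and> b \<le> a"
      then show ?thesis using symbol_coeff_monom_top[of \<alpha> "[:\<eta>, \<xi>:]" i]
        by (auto simp: l coeff_Fop_monom)
    qed
  qed
  then show ?thesis using F(1) by (auto simp: tens_carrier_def)
qed

text \<open>If the s-degree i of F is positive, then i + 2 \<ge> 3, and A_(i+2) multiplies the
  leading coefficient of F by \<alpha> \<xi> up to sign, which is nonzero.\<close>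

lemma degree_s_zero_iff:
  assumes F: "F \<in> tens_carrier"
  shows "(\<forall>j\<ge>3. A j F = 0) \<longleftrightarrow> (\<forall>a i. i > 0 \<longrightarrow> F (a, i) = 0)"
proof
  assume 0: "\<forall>a i. i > 0 \<longrightarrow> F (a, i) = 0"
  show "\<forall>j\<ge>3. A j F = 0"
  proof (intro allI impI)
    fix j :: nat assume j: "j \<ge> 3"
    show "A j F = 0"
      unfolding lift_def
    proof (intro sum.neutral ballI)
      fix k assume "k \<in> {k. F k \<noteq> 0}"
      then have "snd k = 0" using 0[rule_format, of "snd k" "fst k"] by auto
      then show "tens sc (symbol_coeff \<alpha> [:\<eta>, \<xi>:] j (bmonom k)) (F k) = 0"
        using symbol_coeff_monom_eq_0[of 0 j \<alpha> "[:\<eta>, \<xi>:]" "monom 1 (fst k)"] j by simp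
    qed
  qed
next
  assume A: "\<forall>j\<ge>3. A j F = 0"
  show "\<forall>a i. i > 0 \<longrightarrow> F (a, i) = 0"
  proof (rule ccontr)
    assume "\<not> (\<forall>a i. i > 0 \<longrightarrow> F (a, i) = 0)"
    then obtain a0 i0 where 0: "i0 > 0" "F (a0, i0) \<noteq> 0" by blast
    have fin: "finite {k. F k \<noteq> 0}" using F by (simp add: tens_carrier_def)
    define i where "i = Max (snd ` {k. F k \<noteq> 0})"
    have i_max: "i' \<le> i" if "F (a', i') \<noteq> 0" for a' i'
      unfolding i_def using fin that by (intro Max_ge) (auto intro!: rev_image_eqI)
    then have i: "i > 0" using 0 by fastforce
    have "i \<in> snd ` {k. F k \<noteq> 0}" unfolding i_def using fin 0(2) by (intro Max_in) auto
    then obtain a1 where a1: "F (a1, i) \<noteq> 0" by auto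
    have fin': "finite {a. F (a, i) \<noteq> 0}"
      by (rule finite_subset[OF _ finite_imageI[OF fin, of fst]]) force
    define a where "a = Max {a. F (a, i) \<noteq> 0}"
    have a_max: "a' \<le> a" if "F (a', i) \<noteq> 0" for a'
      unfolding a_def using fin' that by simp
    have a: "F (a, i) \<noteq> 0" using Max_in[OF fin'] a1 by (auto simp: a_def)
    have "A (i + 2) F (a, 0) = sc (- ((-1) ^ i * \<alpha> * \<xi>)) (F (a, i))"
      using F i_max a_max by (intro A_top_apply) (auto simp: not_le[symmetric])
    moreover have "A (i + 2) F = 0" using A i by simp
    ultimately show False using a nonzero by simp
  qed
qed

lemma A_2_apply:
  assumes F: "F \<in> tens_carrier" "\<And>a i. i > 0 \<Longrightarrow> F (a, i) = 0"
  shows "A 2 F (a, 0) = sc (- (\<alpha> * \<xi>)) (F (a, 0)) + sc (\<alpha> * of_nat (Suc a)) (F (Suc a, 0))"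
proof -
  define S where "S = {l. F l \<noteq> 0} \<union> {(a, 0), (Suc a, 0)}"
  have S: "finite S" using F(1) by (simp add: S_def tens_carrier_def)
  have "A 2 F (a, 0) = (\<Sum>l\<in>S. sc (coeff2 (symbol_coeff \<alpha> [:\<eta>, \<xi>:] 2 (bmonom l)) (a, 0)) (F l))"
    unfolding A_apply[OF F(1)]
    by (rule sum.mono_neutral_left[OF S]) (auto simp: S_def)
  also have "\<dots> = (\<Sum>l\<in>S. (if l = (a, 0) then sc (- (\<alpha> * \<xi>)) (F (a, 0)) else 0)
      + (if l = (Suc a, 0) then sc (\<alpha> * of_nat (Suc a)) (F (Suc a, 0)) else 0))"
  proof (intro sum.cong refl)
    fix l assume "l \<in> S"
    obtain b i where l: "l = (b, i)" by fastforce
    show "sc (coeff2 (symbol_coeff \<alpha> [:\<eta>, \<xi>:] 2 (bmonom l)) (a, 0)) (F l)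
      = (if l = (a, 0) then sc (- (\<alpha> * \<xi>)) (F (a, 0)) else 0)
      + (if l = (Suc a, 0) then sc (\<alpha> * of_nat (Suc a)) (F (Suc a, 0)) else 0)"
      using F(2)[of i b] symbol_coeff_2_const[of \<alpha> "[:\<eta>, \<xi>:]" "monom 1 b"]
      by (cases "i = 0") (auto simp: l monom_0 coeff_Fop_monom algebra_simps)
  qed
  also have "\<dots> = sc (- (\<alpha> * \<xi>)) (F (a, 0)) + sc (\<alpha> * of_nat (Suc a)) (F (Suc a, 0))"
    using S by (simp add: sum.distrib S_def)
  finally show ?thesis .
qed

lemma tens_1_apply: "tens sc 1 v k = (if k = (0, 0) then v else 0)"
  using tens_mono_pointwise[of "(0, 0)" v k] by (simp add: one_pCons monom_0)

text \<open>On C[t] \<otimes> V the operator A_2 is -\<alpha> \<xi> plus the locally nilpotent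
  \<alpha> d/dt. The top t-degree shows the eigenvalue; then the derivative of F must
  vanish.\<close>

lemma A_2_eigenvector:
  assumes F: "F \<in> tens_carrier" "\<And>a i. i > 0 \<Longrightarrow> F (a, i) = 0" "F \<noteq> 0"
    and eig: "A 2 F = scl (- \<beta>) F"
  shows "\<beta> = \<alpha> * \<xi>" "F = tens sc 1 (F (0, 0))"
proof -
  have fin: "finite {a. F (a, 0) \<noteq> 0}"
    using F(1) by (intro finite_subset[OF _ finite_imageI[of "{k. F k \<noteq> 0}" fst]]) (force simp: tens_carrier_def)+
  obtain k where k: "F k \<noteq> 0" using F(3) by (auto simp: fun_eq_iff)
  then obtain a1 where a1: "F (a1, 0) \<noteq> 0" using F(2)[of "snd k" "fst k"] by (cases k) auto
  define a where "a = Max {a. F (a, 0) \<noteq> 0}"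
  have "F (a, 0) \<noteq> 0" using Max_in[OF fin] a1 by (auto simp: a_def)
  moreover have "F (Suc a, 0) = 0" using Max_ge[OF fin, of "Suc a"] by (auto simp: a_def)
  moreover have "scl (- \<beta>) F (a, 0) = sc (- (\<alpha> * \<xi>)) (F (a, 0)) + sc (\<alpha> * of_nat (Suc a)) (F (Suc a, 0))"
    unfolding eig[symmetric] by (rule A_2_apply[OF F(1,2)])
  ultimately have "sc (\<beta> - \<alpha> * \<xi>) (F (a, 0)) = 0"
    by (simp add: tens_scale_def scale_left_diff_distrib)
  then show \<beta>: "\<beta> = \<alpha> * \<xi>" using \<open>F (a, 0) \<noteq> 0\<close> by simp
  have "F (Suc a, 0) = 0" for a
  proof -
    have "scl (- \<beta>) F (a, 0) = sc (- (\<alpha> * \<xi>)) (F (a, 0)) + sc (\<alpha> * of_nat (Suc a)) (F (Suc a, 0))"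
      unfolding eig[symmetric] by (rule A_2_apply[OF F(1,2)])
    then have "sc (\<alpha> * of_nat (Suc a)) (F (Suc a, 0)) = 0" by (simp add: tens_scale_def \<beta>)
    then show ?thesis using nonzero(2) by (metis mult_eq_0_iff of_nat_eq_0_iff scale_eq_0_iff old.nat.distinct(2))
  qed
  then have "F (a, i) = 0" if "(a, i) \<noteq> (0, 0)" for a i
    using F(2)[of i a] that by (cases "i = 0"; cases a) auto
  then show "F = tens sc 1 (F (0, 0))"
    by (auto simp: fun_eq_iff tens_1_apply)
qed

lemma A_2_tens_1: "A 2 (tens sc 1 v) = scl (- (\<alpha> * \<xi>)) (tens sc 1 v)"
proof -
  have "symbol_coeff \<alpha> [:\<eta>, \<xi>:] 2 1 = smult [:- (\<alpha> * \<xi>):] 1"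
    using symbol_coeff_2_const[of \<alpha> "[:\<eta>, \<xi>:]" 1] by (simp add: Fop_linear_poly one_pCons)
  then show ?thesis by (simp only: A_tens tens_smult)
qed

end

subsection \<open>Isomorphisms of tensor products\<close>

locale omega_tensor_iso = M: omega_tensor sc1 D1 C1 lam1 \<alpha>1 \<xi>1 \<eta>1 + N: omega_tensor sc2 D2 C2 lam2 \<alpha>2 \<xi>2 \<eta>2
  for sc1 :: "complex \<Rightarrow> 'v::ab_group_add \<Rightarrow> 'v" and D1 C1 lam1 \<alpha>1 \<xi>1 \<eta>1
    and sc2 :: "complex \<Rightarrow> 'w::ab_group_add \<Rightarrow> 'w" and D2 C2 lam2 \<alpha>2 \<xi>2 \<eta>2 +
  fixes \<psi>
  assumes iso: "vir_iso
    (tens_scale sc1) tens_carrier (tens_act sc1 lam1 \<alpha>1 [:\<eta>1, \<xi>1:] D1) (tens_C C1)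
    (tens_scale sc2) tens_carrier (tens_act sc2 lam2 \<alpha>2 [:\<eta>2, \<xi>2:] D2) (tens_C C2) \<psi>"
begin

lemma \<psi>_bij: "bij_betw \<psi> tens_carrier tens_carrier"
  and \<psi>_add: "F \<in> tens_carrier \<Longrightarrow> G \<in> tens_carrier \<Longrightarrow> \<psi> (F + G) = \<psi> F + \<psi> G"
  and \<psi>_scl: "F \<in> tens_carrier \<Longrightarrow> \<psi> (M.scl a F) = N.scl a (\<psi> F)"
  and \<psi>_act: "F \<in> tens_carrier \<Longrightarrow> \<psi> (M.act m F) = N.act m (\<psi> F)"
  and \<psi>_C: "F \<in> tens_carrier \<Longrightarrow> \<psi> (tens_C C1 F) = tens_C C2 (\<psi> F)"
  using iso by (simp_all only: vir_iso_def)

lemma \<psi>_in_carrier: "F \<in> tens_carrier \<Longrightarrow> \<psi> F \<in> tens_carrier"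
  using \<psi>_bij by (rule bij_betwE[THEN bspec])

lemma \<psi>_0: "\<psi> 0 = 0"
  using \<psi>_add[of 0 0] by simp

lemma \<psi>_eq_0_iff: "F \<in> tens_carrier \<Longrightarrow> \<psi> F = 0 \<longleftrightarrow> F = 0"
  using \<psi>_bij \<psi>_0 by (metis bij_betw_inv_into_left tens_carrier_0)

lemma \<psi>_sum:
  assumes "\<And>i. i \<in> S \<Longrightarrow> F i \<in> tens_carrier"
  shows "\<psi> (sum F S) = (\<Sum>i\<in>S. \<psi> (F i))"
  using assms
proof (induction S rule: infinite_finite_induct)
  case (insert x S)
  then show ?case
    by (simp only: sum.insert[OF insert.hyps] \<psi>_add tens_carrier_sum insertI1 insertI2)
qed (simp_all only: sum.infinite sum.empty \<psi>_0 not_False_eq_True)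

lemma \<psi>_expansion:
  assumes "F \<in> tens_carrier"
  shows "\<psi> (M.scl a (\<Sum>j\<le>J. M.scl (c j) (M.A j F))) = N.scl a (\<Sum>j\<le>J. N.scl (c j) (\<psi> (M.A j F)))"
  by (simp only: \<psi>_scl \<psi>_sum tens_carrier_sum M.scl_in_carrier M.id.lift_in_carrier)

text \<open>Both sides of \<psi> (d_m F) = d_m \<psi> (F) are exponential polynomials for large m;
  their coefficients are compared in each coordinate.\<close>

lemma \<psi>_A_cases:
  assumes F: "F \<in> tens_carrier"
  shows "if lam1 = lam2 then \<psi> (M.A j F) = N.A j (\<psi> F) else \<psi> (M.A j F) = 0 \<and> N.A j (\<psi> F) = 0"
proof -
  obtain J1 N1 where 1: "\<And>J m. J \<ge> J1 \<Longrightarrow> m \<ge> N1 \<Longrightarrow>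
      M.act (int m) F = M.scl (lam1 ^ m) (\<Sum>j\<le>J. M.scl (of_nat m ^ j) (M.A j F))"
    using M.act_expansion[OF F] by blast
  obtain J2 N2 where 2: "\<And>J m. J \<ge> J2 \<Longrightarrow> m \<ge> N2 \<Longrightarrow>
      N.act (int m) (\<psi> F) = N.scl (lam2 ^ m) (\<Sum>j\<le>J. N.scl (of_nat m ^ j) (N.A j (\<psi> F)))"
    using N.act_expansion[OF \<psi>_in_carrier[OF F]] by blast
  define J where "J = max j (max J1 J2)"
  have eq: "N.scl (lam1 ^ m) (\<Sum>j\<le>J. N.scl (of_nat m ^ j) (\<psi> (M.A j F)))
      = N.scl (lam2 ^ m) (\<Sum>j\<le>J. N.scl (of_nat m ^ j) (N.A j (\<psi> F)))" if "m \<ge> max N1 N2" for m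
    using 1[of J m] 2[of J m] that \<psi>_act[OF F, of "int m"] \<psi>_expansion[OF F, where a = "lam1 ^ m" and J = J]
    by (simp add: J_def)
  have "if lam1 = lam2 then \<psi> (M.A j F) k = N.A j (\<psi> F) k
      else \<psi> (M.A j F) k = 0 \<and> N.A j (\<psi> F) k = 0" for k
  proof (rule N.exp_poly_independent[OF M.nonzero(1) N.nonzero(1)])
    show "j \<le> J" by (simp add: J_def)
    show "sc2 (lam1 ^ m) (\<Sum>j\<le>J. sc2 (of_nat m ^ j) (\<psi> (M.A j F) k))
        = sc2 (lam2 ^ m) (\<Sum>j\<le>J. sc2 (of_nat m ^ j) (N.A j (\<psi> F) k))" if "m \<ge> max N1 N2" for m
      using fun_cong[OF eq[OF that], of k] by (simp only: tens_scale_def sum_fun_apply)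
  qed
  then show ?thesis by (cases "lam1 = lam2") (auto simp: fun_eq_iff)
qed

text \<open>Otherwise A_0 would vanish, but it is multiplication by s.\<close>

lemma lam_eq: "lam1 = lam2"
proof (rule ccontr)
  assume "lam1 \<noteq> lam2"
  obtain v :: 'v where v: "v \<noteq> 0" using M.nontrivial by blast
  have "M.A 0 (tens sc1 1 v) = tens sc1 (monom 1 1) v"
    by (simp add: M.A_tens symbol_coeff_0 monom_Suc one_pCons monom_0)
  moreover have "tens sc1 (monom 1 1) v \<noteq> 0"
  proof
    assume "tens sc1 (monom 1 1) v = 0"
    then have "tens sc1 (monom 1 1) v (0, 1) = 0" by simp
    then show False using v by (simp add: tens_apply)
  qed
  ultimately show False
    using \<psi>_A_cases[OF M.tens_in_carrier, of 0 1 v] \<open>lam1 \<noteq> lam2\<close>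
      \<psi>_eq_0_iff[OF M.tens_in_carrier, of "monom 1 1" v] by simp
qed

lemma \<psi>_A: "F \<in> tens_carrier \<Longrightarrow> \<psi> (M.A j F) = N.A j (\<psi> F)"
  using \<psi>_A_cases lam_eq by simp

section \<open>The map \<tau> and the shape of \<psi>\<close>

lemma \<psi>_tens_1_eigen:
  shows "N.A 2 (\<psi> (tens sc1 1 v)) = N.scl (- (\<alpha>1 * \<xi>1)) (\<psi> (tens sc1 1 v))"
    and "i > 0 \<Longrightarrow> \<psi> (tens sc1 1 v) (a, i) = 0"
proof -
  have c: "tens sc1 1 v \<in> tens_carrier" by (rule M.tens_in_carrier)
  show "N.A 2 (\<psi> (tens sc1 1 v)) = N.scl (- (\<alpha>1 * \<xi>1)) (\<psi> (tens sc1 1 v))"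
    using \<psi>_A[OF c, of 2] \<psi>_scl[OF c] by (simp only: M.A_2_tens_1)
  have "\<forall>a i. i > 0 \<longrightarrow> tens sc1 1 v (a, i) = 0" by (simp add: M.tens_1_apply)
  then have "M.A j (tens sc1 1 v) = 0" if "j \<ge> 3" for j
    using M.degree_s_zero_iff[OF c] that by blast
  then have "N.A j (\<psi> (tens sc1 1 v)) = 0" if "j \<ge> 3" for j
    using \<psi>_A[OF c, of j] that \<psi>_0 by simp
  then show "\<psi> (tens sc1 1 v) (a, i) = 0" if "i > 0"
    using N.degree_s_zero_iff[OF \<psi>_in_carrier[OF c]] that by blast
qed

text \<open>Reading one coordinate loses nothing, since \<psi> (1 \<otimes> v) lies in 1 \<otimes>
  W; see \<open>\<psi>_tens_1\<close>.\<close>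

definition \<tau> :: "'v \<Rightarrow> 'w" where "\<tau> v = \<psi> (tens sc1 1 v) (0, 0)"

lemma beta_eq: "\<alpha>1 * \<xi>1 = \<alpha>2 * \<xi>2"
proof -
  obtain v :: 'v where v: "v \<noteq> 0" using M.nontrivial by blast
  have c: "tens sc1 1 v \<in> tens_carrier" by (rule M.tens_in_carrier)
  have "tens sc1 1 v (0, 0) \<noteq> 0" using v by (simp add: M.tens_1_apply)
  then have "tens sc1 1 v \<noteq> 0" by auto
  then have "\<psi> (tens sc1 1 v) \<noteq> 0" using \<psi>_eq_0_iff[OF c] by simp
  then show ?thesis
    using N.A_2_eigenvector(1)[OF \<psi>_in_carrier[OF c] \<psi>_tens_1_eigen(2) _ \<psi>_tens_1_eigen(1)] by blast
qed

lemma \<psi>_tens_1: "\<psi> (tens sc1 1 v) = tens sc2 1 (\<tau> v)"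
proof (cases "\<psi> (tens sc1 1 v) = 0")
  case True
  then show ?thesis by (simp add: \<tau>_def)
next
  case False
  show ?thesis
    unfolding \<tau>_def
    by (rule N.A_2_eigenvector(2)[OF \<psi>_in_carrier[OF M.tens_in_carrier] \<psi>_tens_1_eigen(2) False \<psi>_tens_1_eigen(1)])
qed

lemma \<tau>_eqI: "\<psi> (tens sc1 1 v) = tens sc2 1 w \<Longrightarrow> \<tau> v = w"
  by (simp add: \<tau>_def N.tens_1_apply)

lemma \<tau>_add: "\<tau> (v + w) = \<tau> v + \<tau> w"
  by (rule \<tau>_eqI)
    (simp only: M.tens_add_right N.tens_add_right \<psi>_add[OF M.tens_in_carrier M.tens_in_carrier] \<psi>_tens_1)

lemma \<tau>_scale: "\<tau> (sc1 a v) = sc2 a (\<tau> v)"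
  by (rule \<tau>_eqI)
    (simp only: M.tens_scale_right N.tens_scale_right \<psi>_scl[OF M.tens_in_carrier] \<psi>_tens_1)

lemma \<tau>_C: "\<tau> (C1 v) = C2 (\<tau> v)"
  by (rule \<tau>_eqI)
    (simp only: M.C_tens[symmetric] N.C_tens[symmetric] \<psi>_C[OF M.tens_in_carrier] \<psi>_tens_1)

text \<open>For every m, not just large ones, d_m 1 \<otimes> v is a combination of A_j (1 \<otimes>
  v) with j \<le> 2 and so is carried over by \<psi>. Subtracting it from d_m (1 \<otimes> v) leaves
  1 \<otimes> d_m v.\<close>

lemma \<tau>_D: "\<tau> (D1 m v) = D2 m (\<tau> v)"
proof (rule \<tau>_eqI)
  have "\<psi> (tens sc1 (omega_act lam1 \<alpha>1 [:\<eta>1, \<xi>1:] m 1) v)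
      = tens sc2 (omega_act lam2 \<alpha>2 [:\<eta>2, \<xi>2:] m 1) (\<tau> v)"
    using M.tens_omega_act[of 1 2 m v] N.tens_omega_act[of 1 2 m "\<tau> v"] lam_eq
    by (simp only: degree_1 add_0 order.refl \<psi>_expansion[OF M.tens_in_carrier] \<psi>_A[OF M.tens_in_carrier] \<psi>_tens_1)
  moreover have "\<psi> (tens sc1 (omega_act lam1 \<alpha>1 [:\<eta>1, \<xi>1:] m 1) v + tens sc1 1 (D1 m v))
      = tens sc2 (omega_act lam2 \<alpha>2 [:\<eta>2, \<xi>2:] m 1) (\<tau> v) + tens sc2 1 (D2 m (\<tau> v))"
    using \<psi>_act[OF M.tens_in_carrier, of m 1 v] by (simp only: M.act_tens \<psi>_tens_1 N.act_tens)
  ultimately show "\<psi> (tens sc1 1 (D1 m v)) = tens sc2 1 (D2 m (\<tau> v))"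
    unfolding \<psi>_add[OF M.tens_in_carrier M.tens_in_carrier] by (metis add_left_cancel)
qed

lemma \<psi>_tens_step:
  assumes "\<psi> (tens sc1 P v) = tens sc2 Q w"
  shows "\<psi> (tens sc1 (symbol_coeff \<alpha>1 [:\<eta>1, \<xi>1:] j P) v) = tens sc2 (symbol_coeff \<alpha>2 [:\<eta>2, \<xi>2:] j Q) w"
  using \<psi>_A[OF M.tens_in_carrier, of j P v] by (simp only: assms M.A_tens N.A_tens)

lemma \<psi>_tens_comb:
  assumes "\<psi> (tens sc1 P v) = tens sc2 P' w" "\<psi> (tens sc1 Q v) = tens sc2 Q' w"
  shows "\<psi> (tens sc1 (P + smult [:a:] Q) v) = tens sc2 (P' + smult [:a:] Q') w"
  using assms
  by (simp only: M.tens_add_left N.tens_add_left M.tens_smult N.tens_smult \<psi>_add \<psi>_scl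
      M.tens_in_carrier M.scl_in_carrier)

text \<open>\<psi> commutes with A_1 = G, and the powers of h_1 and the g_n (h_2) satisfy the same
  three-term relation because the two \<beta> agree.\<close>

lemma \<psi>_formula_const:
  "\<psi> (tens sc1 [:[:\<eta>1, \<xi>1:] ^ n:] v) = tens sc2 [:gpoly (\<eta>2 - \<eta>1) n [:\<eta>2, \<xi>2:]:] (\<tau> v)"
proof (induction n rule: less_induct)
  case (less n)
  let ?h1 = "[:\<eta>1, \<xi>1:]" and ?h2 = "[:\<eta>2, \<xi>2:]" and ?c = "\<eta>2 - \<eta>1"
  have base: "\<psi> (tens sc1 [:?h1 ^ 0:] v) = tens sc2 [:gpoly ?c 0 ?h2:] (\<tau> v)"
    using \<psi>_tens_1[of v] by (simp add: one_pCons)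
  consider "n = 0" | "n = 1" | k where "n = Suc (Suc k)"
    by (cases n; cases "n - 1") auto
  then show ?case
  proof cases
    case 1
    then show ?thesis using base by simp
  next
    case 2
    have "\<psi> (tens sc1 ([:Gop \<alpha>1 ?h1 (?h1 ^ 0):] + smult [:- (\<alpha>1 * \<xi>1):] [:?h1 ^ 0:]) v)
        = tens sc2 ([:Gop \<alpha>2 ?h2 (gpoly ?c 0 ?h2):] + smult [:- (\<alpha>1 * \<xi>1):] [:gpoly ?c 0 ?h2:]) (\<tau> v)"
      using \<psi>_tens_step[OF base, of 1] by (intro \<psi>_tens_comb base) (simp only: symbol_coeff_1_const)
    then show ?thesis using 2 beta_eq by (simp add: Gop_1 gpoly_1)
  next
    case 3
    let ?n = "of_nat (Suc k) :: complex"
    have IH: "\<psi> (tens sc1 [:?h1 ^ Suc k:] v) = tens sc2 [:gpoly ?c (Suc k) ?h2:] (\<tau> v)"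
      "\<psi> (tens sc1 [:?h1 ^ k:] v) = tens sc2 [:gpoly ?c k ?h2:] (\<tau> v)"
      by (rule less.IH, simp add: 3)+
    have "\<psi> (tens sc1 ([:Gop \<alpha>1 ?h1 (?h1 ^ Suc k):] + smult [:- (\<alpha>1 * \<xi>1 - ?n):] [:?h1 ^ Suc k:]
          + smult [:- (\<eta>1 * ?n):] [:?h1 ^ k:]) v)
        = tens sc2 ([:Gop \<alpha>2 ?h2 (gpoly ?c (Suc k) ?h2):] + smult [:- (\<alpha>1 * \<xi>1 - ?n):] [:gpoly ?c (Suc k) ?h2:]
          + smult [:- (\<eta>1 * ?n):] [:gpoly ?c k ?h2:]) (\<tau> v)"
      using \<psi>_tens_step[OF IH(1), of 1] by (intro \<psi>_tens_comb IH) (simp only: symbol_coeff_1_const)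
    moreover have "[:Gop \<alpha>1 ?h1 (?h1 ^ Suc k):] + smult [:- (\<alpha>1 * \<xi>1 - ?n):] [:?h1 ^ Suc k:]
        + smult [:- (\<eta>1 * ?n):] [:?h1 ^ k:] = [:?h1 ^ n:]"
    proof -
      have "[:c:] * p = smult c p" for c and p :: "complex poly" by simp
      then show ?thesis unfolding Gop_power_Suc 3
        by (simp add: smult_diff_left del: of_nat_Suc mult_pCons_left mult_pCons_right power_Suc)
    qed
    moreover have "[:Gop \<alpha>2 ?h2 (gpoly ?c (Suc k) ?h2):] + smult [:- (\<alpha>1 * \<xi>1 - ?n):] [:gpoly ?c (Suc k) ?h2:]
        + smult [:- (\<eta>1 * ?n):] [:gpoly ?c k ?h2:] = [:gpoly ?c n ?h2:]"
      unfolding Gop_gpoly_Suc 3 beta_eq by (simp add: smult_diff_left del: of_nat_Suc)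
    ultimately show ?thesis by simp
  qed
qed

lemma \<psi>_formula:
  "\<psi> (tens sc1 (monom ([:\<eta>1, \<xi>1:] ^ n) i) v) = tens sc2 (monom (gpoly (\<eta>2 - \<eta>1) n [:\<eta>2, \<xi>2:]) i) (\<tau> v)"
proof (induction i)
  case 0
  then show ?case using \<psi>_formula_const by (simp add: monom_0)
next
  case (Suc i)
  from \<psi>_tens_step[OF Suc, of 0] show ?case by (simp only: symbol_coeff_0 monom_Suc)
qed

lemma omega_tensor_iso_inverse:
  "omega_tensor_iso sc2 D2 C2 lam2 \<alpha>2 \<xi>2 \<eta>2 sc1 D1 C1 lam1 \<alpha>1 \<xi>1 \<eta>1 (inv_into tens_carrier \<psi>)"
  by unfold_locales
    (rule vir_iso_inverse[OF iso tens_carrier_add M.scl_in_carrier M.act_in_carrier M.C_in_carrier])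

text \<open>The inverse of \<psi> is an isomorphism of the same kind, and its own
  \<open>\<tau>\<close> inverts this one.\<close>

lemma vir_iso_\<tau>: "vir_iso sc1 UNIV D1 C1 sc2 UNIV D2 C2 \<tau>"
proof -
  interpret inv: omega_tensor_iso sc2 D2 C2 lam2 \<alpha>2 \<xi>2 \<eta>2 sc1 D1 C1 lam1 \<alpha>1 \<xi>1 \<eta>1
    "inv_into tens_carrier \<psi>"
    by (rule omega_tensor_iso_inverse)
  have "inv.\<tau> (\<tau> v) = v" for v
    by (rule inv.\<tau>_eqI)
      (simp only: \<psi>_tens_1[symmetric] bij_betw_inv_into_left[OF \<psi>_bij M.tens_in_carrier])
  moreover have "\<tau> (inv.\<tau> w) = w" for w
    by (rule \<tau>_eqI)
      (simp only: inv.\<psi>_tens_1[symmetric] bij_betw_inv_into_right[OF \<psi>_bij N.tens_in_carrier])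
  ultimately have "bij \<tau>" by (intro o_bij[of inv.\<tau>]) (auto simp: fun_eq_iff)
  then show ?thesis by (simp add: vir_iso_def \<tau>_add \<tau>_scale \<tau>_D \<tau>_C)
qed

end

subsection \<open>The isomorphism between the modules \<open>\<Omega>\<close>\<close>

interpretation poly_cvs: complex_vs "smult :: complex \<Rightarrow> complex poly \<Rightarrow> complex poly"
  by unfold_locales

text \<open>The map h_1^n \<mapsto> g_n (h_2): the substitution t = (x - \<eta>1) / \<xi>1 rewrites
  f as a polynomial in x = h_1, and then each x^n is replaced.\<close>

definition base_change :: "complex \<Rightarrow> complex \<Rightarrow> complex \<Rightarrow> complex \<Rightarrow> complex poly \<Rightarrow> complex poly" where
  "base_change \<xi>1 \<eta>1 \<xi>2 \<eta>2 f = seq_comb smult (\<lambda>n. gpoly (\<eta>2 - \<eta>1) n [:\<eta>2, \<xi>2:]) (pcompose f [:- \<eta>1 / \<xi>1, 1 / \<xi>1:])"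

lemma base_change_add: "base_change \<xi>1 \<eta>1 \<xi>2 \<eta>2 (f + g) = base_change \<xi>1 \<eta>1 \<xi>2 \<eta>2 f + base_change \<xi>1 \<eta>1 \<xi>2 \<eta>2 g"
  and base_change_smult: "base_change \<xi>1 \<eta>1 \<xi>2 \<eta>2 (smult a f) = smult a (base_change \<xi>1 \<eta>1 \<xi>2 \<eta>2 f)"
  using poly_cvs.pair.linear_add[OF poly_cvs.linear_seq_comb] poly_cvs.pair.linear_scale[OF poly_cvs.linear_seq_comb]
  by (simp_all add: base_change_def pcompose_add pcompose_smult)

lemma base_change_0 [simp]: "base_change \<xi>1 \<eta>1 \<xi>2 \<eta>2 0 = 0"
  using base_change_smult[of \<xi>1 \<eta>1 \<xi>2 \<eta>2 0 0] by simp

lemma base_change_power: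
  assumes "\<xi>1 \<noteq> 0"
  shows "base_change \<xi>1 \<eta>1 \<xi>2 \<eta>2 ([:\<eta>1, \<xi>1:] ^ n) = gpoly (\<eta>2 - \<eta>1) n [:\<eta>2, \<xi>2:]"
proof -
  have "pcompose [:\<eta>1, \<xi>1:] [:- \<eta>1 / \<xi>1, 1 / \<xi>1:] = [:0, 1:]"
    using assms by (simp add: pcompose_pCons)
  moreover have "pcompose (h ^ n) q = pcompose h q ^ n" for h q :: "complex poly"
    by (induction n) (simp_all add: pcompose_mult pcompose_1)
  ultimately have "pcompose ([:\<eta>1, \<xi>1:] ^ n) [:- \<eta>1 / \<xi>1, 1 / \<xi>1:] = monom 1 n"
    by (simp only: power_X_eq_monom)
  moreover have "seq_comb smult x (monom 1 n) = x n" for x :: "nat \<Rightarrow> complex poly"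
    by (induction n arbitrary: x) (simp_all add: monom_0 monom_Suc poly_cvs.seq_comb_pCons)
  ultimately show ?thesis by (simp add: base_change_def)
qed

lemma additive_eqI_powers:
  fixes \<xi> \<eta> :: complex and \<phi> \<chi> :: "complex poly \<Rightarrow> complex poly"
  assumes "\<xi> \<noteq> 0"
    and \<phi>: "\<And>f g. \<phi> (f + g) = \<phi> f + \<phi> g" "\<And>a f. \<phi> (smult a f) = smult a (\<phi> f)"
    and \<chi>: "\<And>f g. \<chi> (f + g) = \<chi> f + \<chi> g" "\<And>a f. \<chi> (smult a f) = smult a (\<chi> f)"
    and eq: "\<And>n. \<phi> ([:\<eta>, \<xi>:] ^ n) = \<chi> ([:\<eta>, \<xi>:] ^ n)"
  shows "\<phi> f = \<chi> f"
proof -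
  define h where "h = [:\<eta>, \<xi>:]"
  \<comment> \<open>The factor \<open>h ^ n\<close> absorbs the power of h that each
    \<open>pCons\<close> splits off.\<close>
  have "\<phi> (h ^ n * pcompose g h) = \<chi> (h ^ n * pcompose g h)" for g n
  proof (induction g arbitrary: n)
    case 0
    then show ?case using \<phi>(2)[of 0 0] \<chi>(2)[of 0 0] by simp
  next
    case (pCons a g)
    have "h ^ n * pcompose (pCons a g) h = smult a (h ^ n) + h ^ Suc n * pcompose g h"
      by (simp add: pcompose_pCons algebra_simps)
    then show ?case using pCons.IH[of "Suc n"] eq[of n, folded h_def] by (simp only: \<phi> \<chi>)
  qed
  from this[of 0 "pcompose f [:- \<eta> / \<xi>, 1 / \<xi>:]"] show ?thesis
    using assms(1) by (simp add: h_def pcompose_assoc[symmetric] pcompose_pCons)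
qed

text \<open>In powers of h, \<alpha> F is \<beta> (1 - d/dh), and the Appell property makes d/dh act
  on g_n as on h^n.\<close>

lemma base_change_Fop:
  assumes "\<xi>1 \<noteq> 0" "\<alpha>1 * \<xi>1 = \<alpha>2 * \<xi>2"
  shows "base_change \<xi>1 \<eta>1 \<xi>2 \<eta>2 (smult \<alpha>1 (Fop \<alpha>1 [:\<eta>1, \<xi>1:] f))
    = smult \<alpha>2 (Fop \<alpha>2 [:\<eta>2, \<xi>2:] (base_change \<xi>1 \<eta>1 \<xi>2 \<eta>2 f))"
proof (rule additive_eqI_powers[OF assms(1),
      where \<phi> = "\<lambda>f. base_change \<xi>1 \<eta>1 \<xi>2 \<eta>2 (smult \<alpha>1 (Fop \<alpha>1 [:\<eta>1, \<xi>1:] f))"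
        and \<chi> = "\<lambda>f. smult \<alpha>2 (Fop \<alpha>2 [:\<eta>2, \<xi>2:] (base_change \<xi>1 \<eta>1 \<xi>2 \<eta>2 f))"])
  fix n
  let ?B = "base_change \<xi>1 \<eta>1 \<xi>2 \<eta>2" and ?h1 = "[:\<eta>1, \<xi>1:]" and ?h2 = "[:\<eta>2, \<xi>2:]"
  show "?B (smult \<alpha>1 (Fop \<alpha>1 ?h1 (?h1 ^ n))) = smult \<alpha>2 (Fop \<alpha>2 ?h2 (?B (?h1 ^ n)))"
  proof (cases n)
    case 0
    have "smult \<alpha>1 (Fop \<alpha>1 ?h1 (?h1 ^ 0)) = smult (\<alpha>1 * \<xi>1) (?h1 ^ 0)"
      "smult \<alpha>2 (Fop \<alpha>2 ?h2 (gpoly (\<eta>2 - \<eta>1) 0 ?h2)) = smult (\<alpha>2 * \<xi>2) (gpoly (\<eta>2 - \<eta>1) 0 ?h2)"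
      by (simp_all add: Fop_linear_poly)
    then show ?thesis
      by (simp only: 0 base_change_smult base_change_power[OF assms(1)] assms(2))
  next
    case (Suc k)
    have "smult \<alpha>1 (Fop \<alpha>1 ?h1 (?h1 ^ Suc k))
        = smult (\<alpha>1 * \<xi>1) (?h1 ^ Suc k) + smult (- (\<alpha>1 * \<xi>1) * of_nat (Suc k)) (?h1 ^ k)"
      unfolding Fop_linear_poly pderiv_power_Suc
      by (simp add: smult_diff_right pderiv_pCons mult_ac del: of_nat_Suc power_Suc)
    moreover have "smult \<alpha>2 (Fop \<alpha>2 ?h2 (gpoly (\<eta>2 - \<eta>1) (Suc k) ?h2))
        = smult (\<alpha>2 * \<xi>2) (gpoly (\<eta>2 - \<eta>1) (Suc k) ?h2)
          + smult (- (\<alpha>2 * \<xi>2) * of_nat (Suc k)) (gpoly (\<eta>2 - \<eta>1) k ?h2)"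
      unfolding Fop_linear_poly pderiv_gpoly
      by (simp add: smult_diff_right pderiv_pCons mult_ac del: of_nat_Suc)
    ultimately show ?thesis
      by (simp only: Suc base_change_add base_change_smult base_change_power[OF assms(1)] assms(2))
  qed
qed (simp_all add: Fop_add Fop_smult base_change_add base_change_smult smult_add_right mult.commute)

lemma base_change_Gop:
  assumes "\<xi>1 \<noteq> 0" "\<alpha>1 * \<xi>1 = \<alpha>2 * \<xi>2"
  shows "base_change \<xi>1 \<eta>1 \<xi>2 \<eta>2 (Gop \<alpha>1 [:\<eta>1, \<xi>1:] f) = Gop \<alpha>2 [:\<eta>2, \<xi>2:] (base_change \<xi>1 \<eta>1 \<xi>2 \<eta>2 f)"
proof (rule additive_eqI_powers[OF assms(1),
      where \<phi> = "\<lambda>f. base_change \<xi>1 \<eta>1 \<xi>2 \<eta>2 (Gop \<alpha>1 [:\<eta>1, \<xi>1:] f)"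
        and \<chi> = "\<lambda>f. Gop \<alpha>2 [:\<eta>2, \<xi>2:] (base_change \<xi>1 \<eta>1 \<xi>2 \<eta>2 f)"])
  fix n
  let ?B = "base_change \<xi>1 \<eta>1 \<xi>2 \<eta>2" and ?h1 = "[:\<eta>1, \<xi>1:]" and ?h2 = "[:\<eta>2, \<xi>2:]"
  note power = base_change_power[OF assms(1), of \<eta>1 \<xi>2 \<eta>2]
  show "?B (Gop \<alpha>1 ?h1 (?h1 ^ n)) = Gop \<alpha>2 ?h2 (?B (?h1 ^ n))"
  proof (cases n)
    case 0
    have "Gop \<alpha>1 ?h1 (?h1 ^ 0) = ?h1 ^ 1 + smult (\<alpha>1 * \<xi>1) (?h1 ^ 0)" by (simp add: Gop_1)
    then have "?B (Gop \<alpha>1 ?h1 (?h1 ^ 0)) = gpoly (\<eta>2 - \<eta>1) 1 ?h2 + smult (\<alpha>1 * \<xi>1) (gpoly (\<eta>2 - \<eta>1) 0 ?h2)"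
      by (simp only: base_change_add base_change_smult power)
    then show ?thesis using power[of 0] by (simp add: 0 Gop_1 gpoly_1 assms(2))
  next
    case (Suc k)
    show ?thesis unfolding Suc Gop_power_Suc power Gop_gpoly_Suc
      by (simp only: base_change_add base_change_smult power assms(2))
  qed
qed (simp_all only: Gop_add Gop_smult base_change_add base_change_smult)

text \<open>The composite commutes with G and fixes 1, hence fixes all powers of h_1.\<close>

lemma base_change_inverse:
  assumes "\<xi>1 \<noteq> 0" "\<xi>2 \<noteq> 0"
  shows "base_change \<xi>2 \<eta>2 \<xi>1 \<eta>1 (base_change \<xi>1 \<eta>1 \<xi>2 \<eta>2 f) = f"
proof -
  let ?\<theta> = "\<lambda>f. base_change \<xi>2 \<eta>2 \<xi>1 \<eta>1 (base_change \<xi>1 \<eta>1 \<xi>2 \<eta>2 f)" and ?h = "[:\<eta>1, \<xi>1:]"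
  \<comment> \<open>The parameters \<xi>2 for the first G and \<xi>1 for the second give both the
    same \<beta> = \<xi>1 \<xi>2, as \<open>base_change_Gop\<close> requires.\<close>
  have G: "?\<theta> (Gop \<xi>2 ?h f) = Gop \<xi>2 ?h (?\<theta> f)" for f
    using assms by (simp add: base_change_Gop[where ?\<alpha>2.0 = \<xi>1] base_change_Gop[where ?\<alpha>1.0 = \<xi>1] mult.commute)
  have \<theta>_add: "?\<theta> (f + g) = ?\<theta> f + ?\<theta> g" and \<theta>_smult: "?\<theta> (smult a f) = smult a (?\<theta> f)" for f g a
    by (simp_all add: base_change_add base_change_smult)
  have pow: "?\<theta> (?h ^ n) = ?h ^ n" for n
  proof (induction n rule: less_induct)
    case (less n)
    have base: "?\<theta> (?h ^ 0) = ?h ^ 0"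
      using base_change_power[OF assms(1), of \<eta>1 \<xi>2 \<eta>2 0] base_change_power[OF assms(2), of \<eta>2 \<xi>1 \<eta>1 0]
      by simp
    consider "n = 0" | "n = 1" | k where "n = Suc (Suc k)"
      by (cases n; cases "n - 1") auto
    then show ?case
    proof cases
      case 1
      then show ?thesis using base by simp
    next
      case 2
      have "?h ^ 1 = Gop \<xi>2 ?h (?h ^ 0) + smult (- (\<xi>2 * \<xi>1)) (?h ^ 0)" by (simp add: Gop_1)
      then show ?thesis unfolding 2 by (simp only: \<theta>_add \<theta>_smult G base)
    next
      case 3
      have IH: "?\<theta> (?h ^ Suc k) = ?h ^ Suc k" "?\<theta> (?h ^ k) = ?h ^ k"
        by (rule less.IH, simp add: 3)+
      have "?h ^ n = Gop \<xi>2 ?h (?h ^ Suc k) + smult (- (\<xi>2 * \<xi>1 - of_nat (Suc k))) (?h ^ Suc k)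
          + smult (- (\<eta>1 * of_nat (Suc k))) (?h ^ k)"
        unfolding Gop_power_Suc 3 smult_minus_left by simp
      then show ?thesis by (simp only: \<theta>_add \<theta>_smult G IH)
    qed
  qed
  show ?thesis
    by (rule additive_eqI_powers[OF assms(1), of ?\<theta> "\<lambda>f. f" \<eta>1]) (simp_all only: \<theta>_add \<theta>_smult pow)
qed

section \<open>The map \<phi> on C[t,s]\<close>

definition omega_iso :: "complex \<Rightarrow> complex \<Rightarrow> complex \<Rightarrow> complex \<Rightarrow> complex poly poly \<Rightarrow> complex poly poly" where
  "omega_iso \<xi>1 \<eta>1 \<xi>2 \<eta>2 = map_poly (base_change \<xi>1 \<eta>1 \<xi>2 \<eta>2)"

lemma coeff_omega_iso: "coeff (omega_iso \<xi>1 \<eta>1 \<xi>2 \<eta>2 P) i = base_change \<xi>1 \<eta>1 \<xi>2 \<eta>2 (coeff P i)"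
  by (simp add: omega_iso_def coeff_map_poly)

lemma omega_iso_add: "omega_iso \<xi>1 \<eta>1 \<xi>2 \<eta>2 (P + Q) = omega_iso \<xi>1 \<eta>1 \<xi>2 \<eta>2 P + omega_iso \<xi>1 \<eta>1 \<xi>2 \<eta>2 Q"
  and omega_iso_smult: "omega_iso \<xi>1 \<eta>1 \<xi>2 \<eta>2 (smult [:a:] P) = smult [:a:] (omega_iso \<xi>1 \<eta>1 \<xi>2 \<eta>2 P)"
  and omega_iso_pCons: "omega_iso \<xi>1 \<eta>1 \<xi>2 \<eta>2 (pCons f P) = pCons (base_change \<xi>1 \<eta>1 \<xi>2 \<eta>2 f) (omega_iso \<xi>1 \<eta>1 \<xi>2 \<eta>2 P)"
  by (simp_all add: poly_eq_iff coeff_omega_iso base_change_add base_change_smult coeff_pCons split: nat.split)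

lemma poly_linear_omega_iso: "poly_linear (omega_iso \<xi>1 \<eta>1 \<xi>2 \<eta>2)"
  by (rule poly_linearI) (simp_all only: omega_iso_add omega_iso_smult)

lemma omega_iso_monom: "omega_iso \<xi>1 \<eta>1 \<xi>2 \<eta>2 (monom f i) = monom (base_change \<xi>1 \<eta>1 \<xi>2 \<eta>2 f) i"
  by (simp add: omega_iso_def map_poly_monom)

lemma omega_iso_inverse:
  assumes "\<xi>1 \<noteq> 0" "\<xi>2 \<noteq> 0"
  shows "omega_iso \<xi>2 \<eta>2 \<xi>1 \<eta>1 (omega_iso \<xi>1 \<eta>1 \<xi>2 \<eta>2 P) = P"
  by (simp add: poly_eq_iff coeff_omega_iso base_change_inverse assms)

lemma omega_act_monom:
  "omega_act lam \<alpha> h m (monom f i) = smult [:lam powi m:] ([:[:- of_int m:], 1:] ^ i *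
     [:smult (of_int m) (Gop \<alpha> h f) + smult (- ((of_int m)\<^sup>2)) (smult \<alpha> (Fop \<alpha> h f)), f:])"
proof -
  have "poly [:[:0, f:], [:Gop \<alpha> h f:], [:smult (- \<alpha>) (Fop \<alpha> h f):]:] [:[:of_int m:]:]
      = [:smult (of_int m) (Gop \<alpha> h f) + smult (- ((of_int m)\<^sup>2)) (smult \<alpha> (Fop \<alpha> h f)), f:]"
    by (simp add: power2_eq_square smult_diff_right mult_ac)
  moreover have "poly [:[:0, 1:], -1:] [:[:of_int m:]:] = [:[:- of_int m:], 1 :: complex poly:]" by simp
  ultimately show ?thesis
    by (simp only: omega_act_eq_poly_symbol symbol_monom symbol_term_def poly_mult poly_power)
qed

lemma omega_iso_mult_power:
  "omega_iso \<xi>1 \<eta>1 \<xi>2 \<eta>2 ([:[:c:], 1:] ^ i * P) = [:[:c:], 1:] ^ i * omega_iso \<xi>1 \<eta>1 \<xi>2 \<eta>2 P"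
proof (induction i)
  case (Suc i)
  have "[:[:c:], 1:] * Q = smult [:c:] Q + pCons 0 Q" for Q :: "complex poly poly" by simp
  then show ?case unfolding power_Suc mult.assoc
    by (simp only: omega_iso_add omega_iso_smult omega_iso_pCons base_change_0 Suc)
qed simp

lemma omega_iso_act:
  assumes "\<xi>1 \<noteq> 0" "\<alpha>1 * \<xi>1 = \<alpha>2 * \<xi>2"
  shows "omega_iso \<xi>1 \<eta>1 \<xi>2 \<eta>2 (omega_act lam \<alpha>1 [:\<eta>1, \<xi>1:] m P)
    = omega_act lam \<alpha>2 [:\<eta>2, \<xi>2:] m (omega_iso \<xi>1 \<eta>1 \<xi>2 \<eta>2 P)"
proof (rule poly_linear_eqI[where
      \<Phi> = "\<lambda>P. omega_iso \<xi>1 \<eta>1 \<xi>2 \<eta>2 (omega_act lam \<alpha>1 [:\<eta>1, \<xi>1:] m P)" and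
      \<Psi> = "\<lambda>P. omega_act lam \<alpha>2 [:\<eta>2, \<xi>2:] m (omega_iso \<xi>1 \<eta>1 \<xi>2 \<eta>2 P)"])
  fix k
  show "omega_iso \<xi>1 \<eta>1 \<xi>2 \<eta>2 (omega_act lam \<alpha>1 [:\<eta>1, \<xi>1:] m (bmonom k))
    = omega_act lam \<alpha>2 [:\<eta>2, \<xi>2:] m (omega_iso \<xi>1 \<eta>1 \<xi>2 \<eta>2 (bmonom k))"
    unfolding omega_iso_monom omega_act_monom omega_iso_smult omega_iso_mult_power omega_iso_pCons
      base_change_add base_change_smult[of _ _ _ _ "of_int m"] base_change_smult[of _ _ _ _ "- ((of_int m)\<^sup>2)"]
      base_change_Gop[OF assms] base_change_Fop[OF assms]
    by (simp add: omega_iso_def)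
qed (rule poly_linear_comp[OF poly_linear_omega_iso poly_linear_omega_act]
    poly_linear_comp[OF poly_linear_omega_act poly_linear_omega_iso])+

text \<open>On pure tensors \<phi> \<otimes> \<tau> commutes with the action because both factors
  do; its inverse combines the inverse of \<tau> with \<open>omega_iso\<close> for exchanged
  parameters.\<close>

lemma vir_iso_lift:
  assumes "omega_tensor sc1 D1 C1 lam \<alpha>1 \<xi>1" "omega_tensor sc2 D2 C2 lam \<alpha>2 \<xi>2"
    and \<beta>: "\<alpha>1 * \<xi>1 = \<alpha>2 * \<xi>2" and \<tau>: "vir_iso sc1 UNIV D1 C1 sc2 UNIV D2 C2 \<tau>"
  shows "vir_iso
    (tens_scale sc1) tens_carrier (tens_act sc1 lam \<alpha>1 [:\<eta>1, \<xi>1:] D1) (tens_C C1)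
    (tens_scale sc2) tens_carrier (tens_act sc2 lam \<alpha>2 [:\<eta>2, \<xi>2:] D2) (tens_C C2)
    (lift sc2 (omega_iso \<xi>1 \<eta>1 \<xi>2 \<eta>2) \<tau>)"
proof -
  interpret M: omega_tensor sc1 D1 C1 lam \<alpha>1 \<xi>1 \<eta>1 by fact
  interpret N: omega_tensor sc2 D2 C2 lam \<alpha>2 \<xi>2 \<eta>2 by fact
  have bij: "bij \<tau>" and \<tau>_D: "\<And>m v. \<tau> (D1 m v) = D2 m (\<tau> v)" and \<tau>_C: "\<And>v. \<tau> (C1 v) = C2 (\<tau> v)"
    using \<tau> by (auto simp: vir_iso_def)
  interpret f: complex_linear sc1 sc2 \<tau>
    using \<tau> by unfold_locales (auto simp: vir_iso_def)
  interpret g: complex_linear sc2 sc1 "inv \<tau>"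
    using \<tau> vir_iso_inverse[OF \<tau>] by unfold_locales (auto simp: vir_iso_def)
  let ?\<Phi> = "omega_iso \<xi>1 \<eta>1 \<xi>2 \<eta>2" and ?\<Psi> = "omega_iso \<xi>2 \<eta>2 \<xi>1 \<eta>1"
  note lift_tens = f.lift_tens[OF poly_linear_omega_iso]
  have "bij_betw (lift sc2 ?\<Phi> \<tau>) tens_carrier tens_carrier"
  proof (rule bij_betw_byWitness[of _ "lift sc1 ?\<Psi> (inv \<tau>)"])
    show "\<forall>F\<in>tens_carrier. lift sc1 ?\<Psi> (inv \<tau>) (lift sc2 ?\<Phi> \<tau> F) = F"
      using bij by (simp add: lift_comp[OF f.complex_linear_axioms g.complex_linear_axioms
            poly_linear_omega_iso poly_linear_omega_iso] omega_iso_inverse M.nonzero N.nonzero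
          bij_is_inj M.lift_id)
    show "\<forall>F\<in>tens_carrier. lift sc2 ?\<Phi> \<tau> (lift sc1 ?\<Psi> (inv \<tau>) F) = F"
      using bij by (simp add: lift_comp[OF g.complex_linear_axioms f.complex_linear_axioms
            poly_linear_omega_iso poly_linear_omega_iso] omega_iso_inverse M.nonzero N.nonzero
          bij_is_surj surj_f_inv_f N.lift_id)
  qed (auto intro: f.lift_in_carrier g.lift_in_carrier)
  moreover have "lift sc2 ?\<Phi> \<tau> (M.act m F) = N.act m (lift sc2 ?\<Phi> \<tau> F)" if "F \<in> tens_carrier" for m F
    using that
  proof (induction F rule: M.tens_induct)
    case (tens P v)
    show ?case
      by (simp only: M.act_tens N.act_tens lift_tens f.lift_add M.tens_in_carrier
          omega_iso_act[OF M.nonzero(3) \<beta>] \<tau>_D)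
  next
    case (add F G)
    then show ?case by (simp only: M.act_add N.act_add f.lift_add M.act_in_carrier f.lift_in_carrier)
  qed
  moreover have "lift sc2 ?\<Phi> \<tau> (tens_C C1 F) = tens_C C2 (lift sc2 ?\<Phi> \<tau> F)" if "F \<in> tens_carrier" for F
    using that
  proof (induction F rule: M.tens_induct)
    case (tens P v)
    show ?case by (simp only: M.C_tens N.C_tens lift_tens \<tau>_C)
  next
    case (add F G)
    moreover have "tens_C C1 (F + G) = tens_C C1 F + tens_C C1 G"
      by (simp add: tens_C_def fun_eq_iff M.C_add)
    moreover have "tens_C C2 (F' + G') = tens_C C2 F' + tens_C C2 G'" for F' G'
      by (simp add: tens_C_def fun_eq_iff N.C_add)
    ultimately show ?case by (simp only: f.lift_add M.C_in_carrier)
  qed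
  ultimately show ?thesis
    unfolding vir_iso_def by (intro conjI ballI allI f.lift_add f.lift_scale) simp_all
qed

lemma omega_tensor_irreducible:
  assumes irr: "vir_irreducible sc UNIV D C" and fin: "locally_finite_op sc UNIV (D k)" "k \<ge> 1"
    and "lam \<noteq> 0" "\<alpha> \<noteq> 0" "\<xi> \<noteq> 0"
  shows "omega_tensor sc D C lam \<alpha> \<xi>"
proof -
  have mod: "vir_module sc UNIV D C" and ne: "(UNIV :: 'a set) \<noteq> {0}"
    using irr by (auto simp: vir_irreducible_def)
  interpret vector_space sc using mod by (simp add: vir_module_def)
  have lin: "D m (v + w) = D m v + D m w" "D m (sc a v) = sc a (D m v)"
    "C (v + w) = C v + C w" "C (sc a v) = sc a (C v)" for m v w a
    using mod by (simp_all add: vir_module_def)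
  show ?thesis
  proof unfold_locales
    show "\<exists>N. \<forall>n\<ge>N. D n v = 0" for v
      by (rule irreducible_eventually_annihilated[OF irr fin(2,1)])
    show "\<exists>v::'a. v \<noteq> 0" using ne by auto
  qed (simp_all only: lin assms not_False_eq_True)
qed

theorem theorem3p4:
  fixes lam1 lam2 \<alpha>1 \<alpha>2 \<xi>1 \<xi>2 \<eta>1 \<eta>2 :: complex
    and sc1 :: "complex \<Rightarrow> 'v::ab_group_add \<Rightarrow> 'v" and D1 :: "int \<Rightarrow> 'v \<Rightarrow> 'v" and C1 :: "'v \<Rightarrow> 'v"
    and sc2 :: "complex \<Rightarrow> 'w::ab_group_add \<Rightarrow> 'w" and D2 :: "int \<Rightarrow> 'w \<Rightarrow> 'w" and C2 :: "'w \<Rightarrow> 'w"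
  assumes "lam1 \<noteq> 0" "lam2 \<noteq> 0" "\<alpha>1 \<noteq> 0" "\<alpha>2 \<noteq> 0" "\<xi>1 \<noteq> 0" "\<xi>2 \<noteq> 0"
    and "vir_irreducible sc1 UNIV D1 C1" and "vir_irreducible sc2 UNIV D2 C2"
    and "\<exists>K::nat. \<forall>k\<ge>K. locally_finite_op sc1 UNIV (D1 (int k)) \<and> locally_finite_op sc2 UNIV (D2 (int k))"
  shows "(vir_isomorphic
            (tens_scale sc1) tens_carrier (tens_act sc1 lam1 \<alpha>1 [:\<eta>1, \<xi>1:] D1) (tens_C C1)
            (tens_scale sc2) tens_carrier (tens_act sc2 lam2 \<alpha>2 [:\<eta>2, \<xi>2:] D2) (tens_C C2)
          \<longleftrightarrow> lam1 = lam2 \<and> \<alpha>1 * \<xi>1 = \<alpha>2 * \<xi>2 \<and> vir_isomorphic sc1 UNIV D1 C1 sc2 UNIV D2 C2)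
       \<and> (\<forall>\<psi>. vir_iso
                (tens_scale sc1) tens_carrier (tens_act sc1 lam1 \<alpha>1 [:\<eta>1, \<xi>1:] D1) (tens_C C1)
                (tens_scale sc2) tens_carrier (tens_act sc2 lam2 \<alpha>2 [:\<eta>2, \<xi>2:] D2) (tens_C C2) \<psi>
            \<longrightarrow> (\<exists>\<tau>. vir_iso sc1 UNIV D1 C1 sc2 UNIV D2 C2 \<tau> \<and>
                   (\<forall>i n v. \<psi> (tens sc1 (monom ([:\<eta>1, \<xi>1:] ^ n) i) v)
                      = tens sc2 (monom (gpoly (\<eta>2 - \<eta>1) n [:\<eta>2, \<xi>2:]) i) (\<tau> v))))"
    (is "(vir_isomorphic ?s1 ?T ?a1 ?c1 ?s2 ?T' ?a2 ?c2 \<longleftrightarrow> _) \<and> _")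
proof -
  obtain K where K: "\<And>k. k \<ge> K \<Longrightarrow> locally_finite_op sc1 UNIV (D1 (int k))"
    "\<And>k. k \<ge> K \<Longrightarrow> locally_finite_op sc2 UNIV (D2 (int k))"
    using assms(9) by blast
  \<comment> \<open>\<open>max K 1\<close> because the annihilation argument needs k \<ge>
    1.\<close>
  have M: "omega_tensor sc1 D1 C1 lam1 \<alpha>1 \<xi>1" and N: "omega_tensor sc2 D2 C2 lam2 \<alpha>2 \<xi>2"
    by (rule omega_tensor_irreducible[of _ _ _ "int (max K 1)"]; use assms K in simp)+
  have iso: "omega_tensor_iso sc1 D1 C1 lam1 \<alpha>1 \<xi>1 \<eta>1 sc2 D2 C2 lam2 \<alpha>2 \<xi>2 \<eta>2 \<psi>"
    if "vir_iso ?s1 ?T ?a1 ?c1 ?s2 ?T' ?a2 ?c2 \<psi>" for \<psi>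
    using M N that by (simp add: omega_tensor_iso_def omega_tensor_iso_axioms_def)
  have "vir_isomorphic ?s1 ?T ?a1 ?c1 ?s2 ?T' ?a2 ?c2"
    if "lam1 = lam2" "\<alpha>1 * \<xi>1 = \<alpha>2 * \<xi>2" "vir_isomorphic sc1 UNIV D1 C1 sc2 UNIV D2 C2"
    using vir_iso_lift[OF M N[folded that(1)] that(2)] that(1,3) unfolding vir_isomorphic_def by blast
  then show ?thesis
    using omega_tensor_iso.lam_eq[OF iso] omega_tensor_iso.beta_eq[OF iso]
      omega_tensor_iso.vir_iso_\<tau>[OF iso] omega_tensor_iso.\<psi>_formula[OF iso]
    unfolding vir_isomorphic_def by blast
qed

end
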